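(* Consider the $N$-player game and the asynchronous gossip-based algorithm described in the context. Assume: (1) for every $i\in V$, $\Omega_i\subset\mathbb{R}$ is non-empty, compact and convex; $J_i(x_i,x_{-i})$ is $C^1$ in $x_i$ and continuous in $x$; and $J_i(x_i,x_{-i})$ is convex in $x_i$ for every $x_{-i}$; (2) the map $F:\Omega\to\mathbb{R}^N$, $F(x):=[\nabla_{x_i}J_i(x)]_{i\in V}$, is strictly monotone: $(F(x)-F(y))^T(x-y)>0$ for all $x,y\in\Omega$ with $x\neq y$; (3) for every $i\in V$ there exist $\sigma_i>0$ and $L_i>0$ such that $\nabla_{x_i}J_i(x_i,u)$ is Lipschitz continuous in $x_i\in\Omega_i$ with constant $\sigma_i$ for every fixed $u\in\Omega_{-i}$, and Lipschitz continuous in $u\in\Omega_{-i}$ with constant $L_i$ for every fixed $x_i\in\Omega_i$; (4) the communication digraph $G_C$ is strongly connected. Let $x(k)=(x_1(k),\dots,x_N(k))$ be the players' actions generated by the algorithm and let $x^*$ be the Nash equilibrium of the game. Then the sequence $\{x(k)\}$ converges to $x^*$ almost surely.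
   Context: Game. $V=\{1,\dots,N\}$ is the set of players, $\Omega_i\subset\mathbb{R}$ is the action set of player $i$, $\Omega=\prod_{i\in V}\Omega_i$, $\Omega_{-i}=\prod_{j\ne i}\Omega_j$, and $J_i:\Omega\to\mathbb{R}$ is the cost function of player $i$; write $x=(x_i,x_{-i})$. A Nash equilibrium is $x^*\in\Omega$ with $J_i(x_i^*,x_{-i}^* )\le J_i(x_i,x_{-i}^* )$ for all $x_i\in\Omega_i$ and all $i\in V$. Communication digraph. $G_C=(V,E_C)$, $E_C\subseteq V\times V$; $(i,j)\in E_C$ means that $i$ sends information to $j$. $N_C^{\mathrm{in}}(i)=\{j\in V:(j,i)\in E_C\}$. Strongly connected means that there is a directed path between each ordered pair of vertices. Algorithm. Each player $i$ has an arbitrary initial temporary estimate $\tilde x^i(0)=(\tilde x^i_j(0))_{j\in V}\in\Omega$ of all players' actions, and $x_i(0)=\tilde x_i^i(0)$. At each iteration $k=0,1,2,\dots$, independently of the past, $i_k$ is chosen uniformly at random from $V$ and then $j_k$ uniformly at random from $N_C^{\mathrm{in}}(i_k)$. Put $W(k)=I_N-\tfrac12 e_{i_k}(e_{i_k}-e_{j_k})^T$, where $e_i$ are the standard unit vectors of $\mathbb{R}^N$. Let $\tilde x(k)\in\Omega^N\subset\mathbb{R}^{N^2}$ be the stack of $\tilde x^1(k),\dots,\tilde x^N(k)$, and let $\bar x(k)=(W(k)\otimes I_N)\tilde x(k)$, with blocks $\bar x^i(k)=(\bar x^i_i(k),\bar x^i_{-i}(k))$. Then $x_{i_k}(k+1)=T_{\Omega_{i_k}}[x_{i_k}(k)-\alpha_{k,i_k}\nabla_{x_{i_k}}J_{i_k}(x_{i_k}(k),\bar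 x^{i_k}_{-i_k}(k))]$ and $x_i(k+1)=x_i(k)$ for $i\ne i_k$, where $T_{\Omega_i}$ is the Euclidean projection onto $\Omega_i$. Finally $\tilde x^i(k+1)=\bar x^i(k)+(x_i(k+1)-\bar x^i_i(k))e_i$ for all $i\in V$ (so $\tilde x_i^i(k)=x_i(k)$ for all $k$). Step sizes. $\alpha_{k,i}=1/\nu_k(i)$, where $\nu_k(i)$ is the number of updates player $i$ has made up to and including iteration $k$; the step sizes are diminishing: $\sum_k\alpha_{k,i}^2<\infty$ and $\sum_k\alpha_{k,i}=\infty$ for all $i\in V$. *)

theory Defs
  imports "HOL-Probability.Probability"
begin

text \<open>
  The players are the elements of an arbitrary finite (nonempty) type \<open>'n\<close>, so that
  \<open>N = CARD('n)\<close>. An action profile is a vector in \<open>real ^ 'n\<close>.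
  The cost functions \<open>J i\<close> are total, but only their values on the profiles in the
  product of the action sets are ever used.
\<close>

definition profiles :: "('n::finite \<Rightarrow> real set) \<Rightarrow> (real ^ 'n) set" where
  "profiles \<Omega> = {x. \<forall>i. x $ i \<in> \<Omega> i}"

text \<open>\<open>with_action x i t\<close> is the profile \<open>(t, x\<^sub>-\<^sub>i)\<close>.\<close>

definition with_action :: "real ^ 'n::finite \<Rightarrow> 'n \<Rightarrow> real \<Rightarrow> real ^ 'n" where
  "with_action x i t = (\<chi> j. if j = i then t else x $ j)"

definition nash_equilibrium ::
    "('n::finite \<Rightarrow> real set) \<Rightarrow> ('n \<Rightarrow> real ^ 'n \<Rightarrow> real) \<Rightarrow> real ^ 'n \<Rightarrow> bool" where
  "nash_equilibrium \<Omega> J x \<longleftrightarrow>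
     x \<in> profiles \<Omega> \<and> (\<forall>i. \<forall>t\<in>\<Omega> i. J i x \<le> J i (with_action x i t))"

text \<open>
  The derivative of \<open>J i\<close> in the player's own action is taken within the action set, hence
  is one-sided at the end points of an interval. If \<open>\<Omega> i\<close> is a singleton, it is an
  unspecified constant; this is harmless, as the player's action is then fixed.
\<close>

definition own_gradient ::
    "('n::finite \<Rightarrow> real set) \<Rightarrow> ('n \<Rightarrow> real ^ 'n \<Rightarrow> real) \<Rightarrow> 'n \<Rightarrow> real ^ 'n \<Rightarrow> real" where
  "own_gradient \<Omega> J i x =
     vector_derivative (\<lambda>t. J i (with_action x i t)) (at (x $ i) within \<Omega> i)"

definition pseudo_gradient ::
    "('n::finite \<Rightarrow> real set) \<Rightarrow> ('n \<Rightarrow> real ^ 'n \<Rightarrow> real) \<Rightarrow> real ^ 'n \<Rightarrow> real ^ 'n" where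
  "pseudo_gradient \<Omega> J x = (\<chi> i. own_gradient \<Omega> J i x)"

text \<open>Being \<open>C\<^sup>1\<close> in the own action, for every fixed choice of the other players' actions.\<close>

definition C1_in_own_action ::
    "('n::finite \<Rightarrow> real set) \<Rightarrow> ('n \<Rightarrow> real ^ 'n \<Rightarrow> real) \<Rightarrow> 'n \<Rightarrow> bool" where
  "C1_in_own_action \<Omega> J i \<longleftrightarrow>
     (\<forall>x\<in>profiles \<Omega>.
        (\<lambda>t. J i (with_action x i t)) differentiable_on \<Omega> i \<and>
        continuous_on (\<Omega> i) (\<lambda>t. own_gradient \<Omega> J i (with_action x i t)))"

definition strictly_monotone_on ::
    "'a::real_inner set \<Rightarrow> ('a \<Rightarrow> 'a) \<Rightarrow> bool" where
  "strictly_monotone_on S F \<longleftrightarrow>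
     (\<forall>x\<in>S. \<forall>y\<in>S. x \<noteq> y \<longrightarrow> (F x - F y) \<bullet> (x - y) > 0)"

definition in_neighbours :: "('n \<times> 'n) set \<Rightarrow> 'n \<Rightarrow> 'n set" where
  "in_neighbours E i = {j. (j, i) \<in> E}"

definition strongly_connected_digraph :: "('n \<times> 'n) set \<Rightarrow> bool" where
  "strongly_connected_digraph E \<longleftrightarrow> (\<forall>i j. (i, j) \<in> E\<^sup>*)"

text \<open>
  The law of one draw \<open>(i\<^sub>k, j\<^sub>k)\<close>. Strong connectivity makes every set of
  in-neighbours nonempty as soon as there are at least two players; with a single player
  there is only one law on pairs of players.
\<close>

definition gossip_pmf :: "('n::finite \<times> 'n) set \<Rightarrow> ('n \<times> 'n) pmf" where
  "gossip_pmf E =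
     do {i \<leftarrow> pmf_of_set UNIV; j \<leftarrow> pmf_of_set (in_neighbours E i); return_pmf (i, j)}"

text \<open>
  \<open>I\<^sub>N - 1/2 e\<^sub>i (e\<^sub>i - e\<^sub>j)\<^sup>T\<close>; the type annotation only fixes the inner dimension to 1.
\<close>

definition gossip_matrix :: "'n::finite \<Rightarrow> 'n \<Rightarrow> real ^ 'n ^ 'n" where
  "gossip_matrix i j =
     mat 1 - (1/2) *\<^sub>R ((columnvector (axis i 1) :: real ^ 1 ^ 'n) ** rowvector (axis i 1 - axis j 1))"

text \<open>
  \<open>s k\<close> is the pair \<open>(i\<^sub>k, j\<^sub>k)\<close> drawn at iteration \<open>k\<close>. For players without an update so far
  the step size is \<open>1 / 0 = 0\<close>, but it is only used for \<open>i = i\<^sub>k\<close>.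
\<close>

definition update_count :: "(nat \<Rightarrow> 'n \<times> 'n) \<Rightarrow> nat \<Rightarrow> 'n \<Rightarrow> nat" where
  "update_count s k i = card {l. l \<le> k \<and> fst (s l) = i}"

definition step_size :: "(nat \<Rightarrow> 'n \<times> 'n) \<Rightarrow> nat \<Rightarrow> 'n \<Rightarrow> real" where
  "step_size s k i = 1 / real (update_count s k i)"

text \<open>
  The state consists of the action profile \<open>x\<close> and of the stack \<open>X\<close> of temporary estimates,
  stored as the matrix whose row \<open>X $ l\<close> is the estimate of player \<open>l\<close>. In this form the
  product of the Kronecker product of \<open>W\<close> and \<open>I\<^sub>N\<close> with the stacked vector is the matrix
  product \<open>W ** X\<close>: its row \<open>l\<close> is \<open>\<Sum>m. W $ l $ m *\<^sub>R X $ m\<close>.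
\<close>

primrec gossip_state ::
    "('n::finite \<Rightarrow> real set) \<Rightarrow> ('n \<Rightarrow> real ^ 'n \<Rightarrow> real) \<Rightarrow> real ^ 'n ^ 'n \<Rightarrow>
     (nat \<Rightarrow> 'n \<times> 'n) \<Rightarrow> nat \<Rightarrow> (real ^ 'n) \<times> (real ^ 'n ^ 'n)" where
  "gossip_state \<Omega> J X0 s 0 = ((\<chi> i. X0 $ i $ i), X0)"
| "gossip_state \<Omega> J X0 s (Suc k) =
     (let (x, X) = gossip_state \<Omega> J X0 s k;
          (i, j) = s k;
          Xbar = gossip_matrix i j ** X;
          g = own_gradient \<Omega> J i (with_action (Xbar $ i) i (x $ i));
          x' = with_action x i (closest_point (\<Omega> i) (x $ i - step_size s k i * g))
      in (x', \<chi> l. Xbar $ l + (x' $ l - Xbar $ l $ l) *\<^sub>R axis l 1))"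

definition actions ::
    "('n::finite \<Rightarrow> real set) \<Rightarrow> ('n \<Rightarrow> real ^ 'n \<Rightarrow> real) \<Rightarrow> real ^ 'n ^ 'n \<Rightarrow>
     (nat \<Rightarrow> 'n \<times> 'n) \<Rightarrow> nat \<Rightarrow> real ^ 'n" where
  "actions \<Omega> J X0 s k = fst (gossip_state \<Omega> J X0 s k)"

end

theory Submission
  imports Defs
begin

text \<open>
  The argument is pathwise. Almost surely every player is drawn with asymptotic frequency \<open>1/N\<close>,
  and a fixed word of draws that spreads information from each player to everybody recurs with
  positive frequency among the blocks of its length; on such a path everything is deterministic.

  Time is measured by the sum of the step sizes. As player \<open>i\<close> uses the steps \<open>1, 1/2, 1/3, \<dots>\<close>,
  her clock is a harmonic number, and between the iterations \<open>exp (- l) * n\<close> and \<open>n\<close> each of the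
  clocks advances by \<open>l + o(1)\<close>. Meanwhile the actions move by \<open>O(l)\<close>, whereas the spreading word
  recurs an unbounded number of times and contracts the estimation error by a fixed factor each time;
  letting \<open>l\<close> tend to \<open>0\<close>, the estimates become exact in the limit. Hence over such a window
  \<open>|x - x*|\<^sup>2\<close> decreases by \<open>2 l F(x) \<bullet> (x - x*)\<close> up to \<open>O(l\<^sup>2) + o(1)\<close>, and away from
  \<open>x*\<close> the inner product is bounded below, by strict monotonicity and compactness.
\<close>

section \<open>The strong law of large numbers for events and for blocks\<close>

text \<open>Hoeffding's inequality makes the probabilities of a deviation by \<open>e\<close>
  summable in the number of trials, so by Borel-Cantelli almost surely only finitely many occur.
  Letting \<open>e\<close> run through \<open>inverse (Suc r)\<close> keeps the exceptional set
  null.\<close>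

lemma (in prob_space) slln_events:
  fixes Y :: "nat \<Rightarrow> 'a \<Rightarrow> bool"
  assumes indep: "indep_vars (\<lambda>_. count_space UNIV) Y UNIV"
    and p: "\<And>q. prob {w \<in> space M. Y q w} = p"
  shows "AE w in M. (\<lambda>n. real (card {q. q < n \<and> Y q w}) / real n) \<longlonglongrightarrow> p"
proof -
  define X where "X = (\<lambda>q w. of_bool (Y q w) :: real)"
  have Ym [measurable]: "Y q \<in> M \<rightarrow>\<^sub>M count_space UNIV" for q
    using indep by (auto simp: indep_vars_def)
  have Xm [measurable]: "X q \<in> borel_measurable M" for q
    unfolding X_def by measurable
  have indepX: "indep_vars (\<lambda>_. borel) X UNIV"
    unfolding X_def by (rule indep_vars_compose2[OF indep]) auto
  have EX: "expectation (X q) = p" for q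
  proof -
    have "expectation (X q) = expectation (indicat_real {w \<in> space M. Y q w})"
      by (intro Bochner_Integration.integral_cong) (auto simp: X_def indicator_def)
    also have "\<dots> = p"
      using p[of q] by simp
    finally show ?thesis .
  qed
  have card_eq: "real (card {q. q < n \<and> Y q w}) = (\<Sum>q<n. X q w)" for n w
  proof -
    have "(\<Sum>q<n. X q w) = (\<Sum>q\<in>{q. q < n \<and> Y q w}. 1)"
      unfolding X_def by (intro sum.mono_neutral_cong_right) auto
    thus ?thesis by simp
  qed
  have tail: "AE w in M. eventually (\<lambda>n. \<bar>(\<Sum>q<n. X q w) / n - p\<bar> < e) sequentially" if e: "e > 0" for e
  proof -
    \<comment> \<open>The shift to \<open>Suc n\<close> keeps the index set nonempty and hence the
      denominator in Hoeffding's bound positive.\<close>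
    define A where "A = (\<lambda>n. {w \<in> space M. \<bar>(\<Sum>q<Suc n. X q w) - real (Suc n) * p\<bar> \<ge> real (Suc n) * e})"
    have bound: "prob (A n) \<le> 2 * exp (- 2 * e\<^sup>2) ^ Suc n" for n
    proof -
      interpret H: Hoeffding_ineq M "{..<Suc n}" X "\<lambda>_. 0" "\<lambda>_. 1" "real (Suc n) * p"
      proof unfold_locales
        show "indep_vars (\<lambda>_. borel) X {..<Suc n}"
          by (rule indep_vars_subset[OF indepX]) auto
        show "AE x in M. X i x \<in> {0..1}" for i
          by (auto simp: X_def)
        show "real (Suc n) * p \<equiv> \<Sum>i<Suc n. expectation (X i)"
          by (simp add: EX algebra_simps)
      qed simp
      have "prob (A n) \<le> 2 * exp (-2 * (real (Suc n) * e)\<^sup>2 / (\<Sum>i\<in>{..<Suc n}. (1 - 0)\<^sup>2))"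
        unfolding A_def by (rule H.Hoeffding_ineq_abs_ge) (use e in auto)
      also have "-2 * (real (Suc n) * e)\<^sup>2 / (\<Sum>i\<in>{..<Suc n}. (1 - 0)\<^sup>2) = real (Suc n) * (-2 * e\<^sup>2)"
        by (simp add: power2_eq_square del: of_nat_Suc)
      also have "exp \<dots> = exp (- 2 * e\<^sup>2) ^ Suc n"
        by (rule exp_of_nat_mult)
      finally show ?thesis .
    qed
    have "summable (\<lambda>n. prob (A n))"
    proof (rule summable_comparison_test')
      show "summable (\<lambda>n. 2 * exp (- 2 * e\<^sup>2) ^ Suc n)"
        using e by (intro summable_mult) (simp add: summable_geometric)
      show "norm (prob (A n)) \<le> 2 * exp (- 2 * e\<^sup>2) ^ Suc n" for n
        using bound[of n] by simp
    qed
    hence "AE w in M. eventually (\<lambda>n. w \<in> space M - A n) sequentially"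
      by (intro borel_cantelli_AE1) (auto simp: A_def emeasure_eq_measure)
    thus ?thesis
    proof eventually_elim
      case (elim w)
      have "eventually (\<lambda>n. \<bar>(\<Sum>q<Suc n. X q w) / Suc n - p\<bar> < e) sequentially"
        using elim
      proof eventually_elim
        case (elim n)
        hence "\<bar>(\<Sum>q<Suc n. X q w) - real (Suc n) * p\<bar> < real (Suc n) * e"
          by (auto simp: A_def not_le simp del: of_nat_Suc sum.lessThan_Suc)
        moreover have "(\<Sum>q<Suc n. X q w) / Suc n - p = ((\<Sum>q<Suc n. X q w) - real (Suc n) * p) / Suc n"
          by (simp add: field_simps del: of_nat_Suc sum.lessThan_Suc)
        ultimately show ?case
          by (simp add: field_simps del: of_nat_Suc sum.lessThan_Suc)
      qed
      thus ?case
        by (rule iffD1[OF eventually_sequentially_Suc])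
    qed
  qed
  have "AE w in M. \<forall>r. eventually (\<lambda>n. \<bar>(\<Sum>q<n. X q w) / n - p\<bar> < inverse (real (Suc r))) sequentially"
    by (subst AE_all_countable) (auto intro: tail)
  thus ?thesis
  proof eventually_elim
    case (elim w)
    show ?case
    proof (rule tendstoI)
      fix e :: real assume "e > 0"
      then obtain r where r: "inverse (real (Suc r)) < e" using reals_Archimedean by blast
      from elim have "eventually (\<lambda>n. \<bar>(\<Sum>q<n. X q w) / n - p\<bar> < inverse (real (Suc r))) sequentially" by blast
      thus "eventually (\<lambda>n. dist (real (card {q. q < n \<and> Y q w}) / real n) p < e) sequentially"
        by eventually_elim (use r in \<open>auto simp: card_eq dist_real_def\<close>)
    qed
  qed
qed

text \<open>Aligned blocks of length \<open>length w\<close> use disjoint sets of draws, so the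
  events of reading \<open>w\<close> in block \<open>q\<close> are independent, and each has the
  product of the letter probabilities as its probability.\<close>

lemma (in prob_space) slln_blocks:
  fixes X :: "nat \<Rightarrow> 'a \<Rightarrow> 'b::countable" and w :: "'b list" and D :: "'b pmf"
  assumes indep: "indep_vars (\<lambda>_. count_space UNIV) X UNIV"
    and law: "\<And>k. distr M (count_space UNIV) (X k) = measure_pmf D"
    and w: "w \<noteq> []"
  shows "AE \<omega> in M. (\<lambda>n. real (card {q. q < n \<and> (\<forall>r<length w. X (q * length w + r) \<omega> = w ! r)}) / real n)
           \<longlonglongrightarrow> (\<Prod>r<length w. pmf D (w ! r))"
proof (rule slln_events)
  let ?m = "length w"
  have m: "?m > 0" using w by simp
  have Xm [measurable]: "X k \<in> M \<rightarrow>\<^sub>M count_space UNIV" for k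
    using indep by (auto simp: indep_vars_def)
  define K where "K = (\<lambda>q::nat. {q * ?m ..< q * ?m + ?m})"
  have "disjoint_family_on K UNIV"
  proof (unfold disjoint_family_on_def, intro ballI impI)
    fix q q' :: nat assume "q \<noteq> q'"
    have div: "k div ?m = q" if "k \<in> K q" for k q
      using that m by (intro div_nat_eqI) (auto simp: K_def mult.commute)
    show "K q \<inter> K q' = {}"
      using div[of _ q] div[of _ q'] \<open>q \<noteq> q'\<close> by blast
  qed
  from indep_vars_restrict[OF indep _ this]
  have "indep_vars (\<lambda>q. PiM (K q) (\<lambda>_. count_space UNIV)) (\<lambda>q \<omega>. restrict (\<lambda>k. X k \<omega>) (K q)) UNIV"
    by simp
  \<comment> \<open>The restriction to \<open>K q\<close> exhibits the event as a function of the
    draws in its own block alone.\<close>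
  from indep_vars_compose2[OF this, of "\<lambda>q f. \<forall>r<?m. f (q * ?m + r) = w ! r" "\<lambda>_. count_space UNIV"]
  have "indep_vars (\<lambda>_. count_space UNIV)
      (\<lambda>q \<omega>. \<forall>r<?m. restrict (\<lambda>k. X k \<omega>) (K q) (q * ?m + r) = w ! r) UNIV"
    unfolding K_def by measurable
  thus "indep_vars (\<lambda>_. count_space UNIV) (\<lambda>q \<omega>. \<forall>r<?m. X (q * ?m + r) \<omega> = w ! r) UNIV"
    by (simp add: K_def restrict_def cong: conj_cong imp_cong)
  fix q
  have "{\<omega> \<in> space M. \<forall>r<?m. X (q * ?m + r) \<omega> = w ! r}
      = (\<Inter>k\<in>K q. X k -` {w ! (k - q * ?m)} \<inter> space M)"
  proof (intro equalityI subsetI)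
    fix \<omega> assume "\<omega> \<in> (\<Inter>k\<in>K q. X k -` {w ! (k - q * ?m)} \<inter> space M)"
    thus "\<omega> \<in> {\<omega> \<in> space M. \<forall>r<?m. X (q * ?m + r) \<omega> = w ! r}"
      using m by (auto simp: K_def)
  next
    fix \<omega> assume "\<omega> \<in> {\<omega> \<in> space M. \<forall>r<?m. X (q * ?m + r) \<omega> = w ! r}"
    hence "\<omega> \<in> space M" and *: "X (q * ?m + r) \<omega> = w ! r" if "r < ?m" for r using that m by auto
    moreover have "X k \<omega> = w ! (k - q * ?m)" if "k \<in> K q" for k
      using *[of "k - q * ?m"] that by (auto simp: K_def)
    ultimately show "\<omega> \<in> (\<Inter>k\<in>K q. X k -` {w ! (k - q * ?m)} \<inter> space M)"
      using m by auto
  qed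
  also have "prob \<dots> = (\<Prod>k\<in>K q. prob (X k -` {w ! (k - q * ?m)} \<inter> space M))"
    by (rule indep_varsD[OF indep]) (use m in \<open>auto simp: K_def\<close>)
  also have "\<dots> = (\<Prod>k\<in>K q. pmf D (w ! (k - q * ?m)))"
  proof (rule prod.cong)
    fix k
    have "prob (X k -` {w ! (k - q * ?m)} \<inter> space M) = measure (distr M (count_space UNIV) (X k)) {w ! (k - q * ?m)}"
      by (subst measure_distr) auto
    thus "prob (X k -` {w ! (k - q * ?m)} \<inter> space M) = pmf D (w ! (k - q * ?m))"
      by (simp add: law pmf.rep_eq)
  qed simp
  also have "\<dots> = (\<Prod>r<?m. pmf D (w ! r))"
    by (rule prod.reindex_bij_witness[of _ "\<lambda>r. q * ?m + r" "\<lambda>k. k - q * ?m"]) (auto simp: K_def)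
  finally show "prob {\<omega> \<in> space M. \<forall>r<?m. X (q * ?m + r) \<omega> = w ! r} = (\<Prod>r<?m. pmf D (w ! r))" .
qed

section \<open>Harmonic clocks and asymptotic contractions\<close>

text \<open>The infimum \<open>v\<close> of the eventual upper bounds is the limit superior. If it
  were positive, then \<open>V (b n) \<le> v + \<kappa> / 2\<close> eventually, and descent with
  \<open>e = v / 2\<close> would give an eventual upper bound below \<open>v\<close>.\<close>

lemma tendsto_zero_by_descent:
  fixes V :: "nat \<Rightarrow> real"
  assumes nonneg: "\<And>n. 0 \<le> V n" and bounded: "\<And>n. V n \<le> B"
    and descent: "\<And>e. e > 0 \<Longrightarrow> \<exists>\<kappa>>0. \<exists>b. filterlim b at_top sequentially \<and>
                     (\<forall>\<^sub>F n in sequentially. V n \<ge> e \<longrightarrow> V n \<le> V (b n) - \<kappa>)"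
  shows "V \<longlonglongrightarrow> 0"
proof -
  define U where "U = {c. \<forall>\<^sub>F n in sequentially. V n \<le> c}"
  define v where "v = Inf U"
  have U_nonneg: "c \<ge> 0" if "c \<in> U" for c
  proof -
    from that have "\<forall>\<^sub>F n in sequentially. V n \<le> c" by (simp add: U_def)
    then obtain n where "V n \<le> c" using eventually_happens by fastforce
    thus ?thesis using nonneg[of n] by simp
  qed
  have "B \<in> U" using bounded by (simp add: U_def)
  have bdd: "bdd_below U" using U_nonneg by (rule bdd_belowI)
  have ev: "\<forall>\<^sub>F n in sequentially. V n \<le> v + d" if "d > 0" for d
  proof -
    have "Inf U < v + d" using that by (simp add: v_def)
    then obtain c where "c \<in> U" "c < v + d"
      using cInf_lessD[of U "v + d"] \<open>B \<in> U\<close> by blast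
    thus ?thesis by (auto simp: U_def elim!: eventually_mono)
  qed
  have "v \<ge> 0" unfolding v_def using \<open>B \<in> U\<close> U_nonneg by (intro cInf_greatest) auto
  have "\<not> v > 0"
  proof
    assume "v > 0"
    with descent[of "v / 2"] obtain \<kappa> b where \<kappa>: "\<kappa> > 0" and b: "filterlim b at_top sequentially"
      and desc: "\<forall>\<^sub>F n in sequentially. V n \<ge> v / 2 \<longrightarrow> V n \<le> V (b n) - \<kappa>" by auto
    have "\<forall>\<^sub>F n in sequentially. V (b n) \<le> v + \<kappa> / 2"
      using \<kappa> by (intro eventually_compose_filterlim[OF ev b]) auto
    hence "\<forall>\<^sub>F n in sequentially. V n \<le> max (v / 2) (v - \<kappa> / 2)"
      using desc by eventually_elim (auto simp: max_def)
    hence "max (v / 2) (v - \<kappa> / 2) \<in> U" by (simp add: U_def)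
    hence "v \<le> max (v / 2) (v - \<kappa> / 2)" unfolding v_def using bdd by (rule cInf_lower)
    thus False using \<open>v > 0\<close> \<kappa> by (auto simp: max_def split: if_splits)
  qed
  with \<open>v \<ge> 0\<close> have "v = 0" by simp
  show ?thesis
  proof (rule tendstoI)
    fix e :: real assume "e > 0"
    hence "\<forall>\<^sub>F n in sequentially. V n \<le> v + e / 2" by (intro ev) auto
    thus "\<forall>\<^sub>F n in sequentially. dist (V n) 0 < e"
    proof eventually_elim
      case (elim n)
      thus ?case using nonneg[of n] \<open>v = 0\<close> \<open>e > 0\<close> by simp
    qed
  qed
qed

section \<open>Windows of fixed length in harmonic time\<close>

text \<open>The start of the window that ends at \<open>n\<close> and has length about
  \<open>l\<close> in logarithmic time.\<close>

definition look_back :: "real \<Rightarrow> nat \<Rightarrow> nat" where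
  "look_back l n = nat \<lfloor>exp (- l) * real n\<rfloor>"

lemma look_back_le: "l \<ge> 0 \<Longrightarrow> look_back l n \<le> n"
proof -
  assume "l \<ge> 0"
  hence "exp (- l) * real n \<le> 1 * real n" by (intro mult_right_mono) auto
  thus ?thesis unfolding look_back_def by linarith
qed

lemma look_back_ratio: "(\<lambda>n. real (look_back l n) / real n) \<longlonglongrightarrow> exp (- l)"
proof (rule tendsto_sandwich)
  show "\<forall>\<^sub>F n in sequentially. exp (- l) - 1 / real n \<le> real (look_back l n) / real n"
    using eventually_gt_at_top[of 0]
  proof eventually_elim
    case (elim n)
    have "exp (- l) * real n - 1 \<le> real (look_back l n)"
      unfolding look_back_def by linarith
    hence "(exp (- l) * real n - 1) / real n \<le> real (look_back l n) / real n"
      by (rule divide_right_mono) simp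
    thus ?case using elim by (simp add: diff_divide_distrib)
  qed
  show "\<forall>\<^sub>F n in sequentially. real (look_back l n) / real n \<le> exp (- l)"
    using eventually_gt_at_top[of 0]
  proof eventually_elim
    case (elim n)
    have "real (look_back l n) \<le> exp (- l) * real n"
      unfolding look_back_def by simp
    thus ?case using elim by (simp add: field_simps)
  qed
  show "(\<lambda>n. exp (- l) - 1 / real n) \<longlonglongrightarrow> exp (- l)"
    using tendsto_diff[OF tendsto_const[of "exp (- l)"] lim_1_over_n] by simp
qed simp

lemma look_back_at_top: "filterlim (look_back l) at_top sequentially"
proof -
  have "filterlim (\<lambda>n. real (look_back l n) / real n * real n) at_top sequentially"
    by (rule filterlim_tendsto_pos_mult_at_top[OF look_back_ratio _ filterlim_real_sequentially]) simp
  moreover have "real (look_back l n) / real n * real n = real (look_back l n)" for n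
    by (cases "n = 0") (auto simp: look_back_def)
  ultimately have "filterlim (\<lambda>n. real (look_back l n)) at_top sequentially" by simp
  thus ?thesis by (simp add: filterlim_sequentially_iff_filterlim_real)
qed

lemma look_back_inverse_ratio: "(\<lambda>n. real n / real (look_back l n)) \<longlonglongrightarrow> exp l"
  using tendsto_inverse[OF look_back_ratio[of l]] by (simp add: exp_minus)

text \<open>Harmonic numbers are logarithms up to the Euler-Mascheroni constant and a vanishing
  error; the constant cancels in the difference.\<close>

lemma harm_diff_tendsto:
  assumes u: "filterlim u at_top F" and v: "filterlim v at_top F"
    and ratio: "((\<lambda>n. real (u n) / real (v n)) \<longlongrightarrow> exp l) F"
  shows "((\<lambda>n. harm (u n) - harm (v n) :: real) \<longlongrightarrow> l) F"
proof -
  let ?g = "\<lambda>n. harm n - ln (real n) :: real"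
  have "((\<lambda>n. ?g (u n) - ?g (v n) + ln (real (u n) / real (v n)))
          \<longlongrightarrow> euler_mascheroni - euler_mascheroni + ln (exp l)) F"
    by (intro tendsto_intros ratio filterlim_compose[OF euler_mascheroni_LIMSEQ u]
          filterlim_compose[OF euler_mascheroni_LIMSEQ v]) auto
  hence "((\<lambda>n. ?g (u n) - ?g (v n) + ln (real (u n) / real (v n))) \<longlongrightarrow> l) F" by simp
  moreover have "\<forall>\<^sub>F n in F. u n > 0" "\<forall>\<^sub>F n in F. v n > 0"
    using u v by (auto intro: eventually_compose_filterlim[OF eventually_gt_at_top])
  hence "\<forall>\<^sub>F n in F. ?g (u n) - ?g (v n) + ln (real (u n) / real (v n)) = harm (u n) - harm (v n)"
    by eventually_elim (simp add: ln_div)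
  ultimately show ?thesis by (rule Lim_transform_eventually)
qed

lemma positive_frequency_at_top:
  fixes c :: "nat \<Rightarrow> nat"
  assumes c: "(\<lambda>n. real (c n) / real n) \<longlonglongrightarrow> p" and p: "p > 0"
  shows "filterlim c at_top sequentially"
proof -
  have "filterlim (\<lambda>n. real (c n) / real n * real n) at_top sequentially"
    by (rule filterlim_tendsto_pos_mult_at_top[OF c p filterlim_real_sequentially])
  moreover have "\<forall>\<^sub>F n in sequentially. real (c n) / real n * real n = real (c n)"
    using eventually_gt_at_top[of 0] by eventually_elim simp
  ultimately have "filterlim (\<lambda>n. real (c n)) at_top sequentially"
    by (rule filterlim_cong[THEN iffD1, OF refl refl, rotated])
  thus ?thesis by (simp add: filterlim_sequentially_iff_filterlim_real)
qed

text \<open>The frequency \<open>p\<close> cancels in the ratio \<open>c (u n) / c (v n)\<close>, so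
  a harmonic clock that ticks only at counted times advances by the same \<open>l\<close> as one
  that ticks always.\<close>

lemma harm_frequency_diff_tendsto:
  fixes c :: "nat \<Rightarrow> nat"
  assumes c: "(\<lambda>n. real (c n) / real n) \<longlonglongrightarrow> p" and p: "p > 0"
    and u: "filterlim u at_top sequentially" and v: "filterlim v at_top sequentially"
    and ratio: "(\<lambda>n. real (u n) / real (v n)) \<longlonglongrightarrow> exp l"
  shows "(\<lambda>n. harm (c (u n)) - harm (c (v n)) :: real) \<longlonglongrightarrow> l"
proof (rule harm_diff_tendsto)
  note ctop = positive_frequency_at_top[OF c p]
  show "filterlim (\<lambda>n. c (u n)) at_top sequentially" "filterlim (\<lambda>n. c (v n)) at_top sequentially"
    using filterlim_compose[OF ctop u] filterlim_compose[OF ctop v] .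
  have "(\<lambda>n. (real (c (u n)) / real (u n)) / (real (c (v n)) / real (v n)) * (real (u n) / real (v n)))
          \<longlonglongrightarrow> p / p * exp l"
    by (intro tendsto_intros ratio filterlim_compose[OF c u] filterlim_compose[OF c v]) (use p in simp)
  hence "(\<lambda>n. (real (c (u n)) / real (u n)) / (real (c (v n)) / real (v n)) * (real (u n) / real (v n)))
          \<longlonglongrightarrow> exp l" using p by simp
  moreover have "\<forall>\<^sub>F n in sequentially. u n > 0" "\<forall>\<^sub>F n in sequentially. v n > 0"
    using u v by (auto intro: eventually_compose_filterlim[OF eventually_gt_at_top])
  hence "\<forall>\<^sub>F n in sequentially. (real (c (u n)) / real (u n)) / (real (c (v n)) / real (v n)) * (real (u n) / real (v n))
     = real (c (u n)) / real (c (v n))"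
    by eventually_elim simp
  ultimately show "(\<lambda>n. real (c (u n)) / real (c (v n))) \<longlonglongrightarrow> exp l"
    by (rule Lim_transform_eventually)
qed

text \<open>Unrolling \<open>step\<close> over the window from \<open>look_back l n\<close> to
  \<open>n\<close> leaves a power of \<open>\<theta>\<close> times \<open>B\<close> plus the drift.
  Good indices have positive frequency, so the exponent is unbounded and the limit superior of
  \<open>a\<close> is at most \<open>K * l\<close>, for every \<open>l > 0\<close>.\<close>

lemma frequent_contraction_tendsto_zero:
  fixes a S :: "nat \<Rightarrow> real" and good :: "nat \<Rightarrow> bool"
  assumes nonneg: "\<And>n. 0 \<le> a n" and bounded: "\<And>n. a n \<le> B"
    and step: "\<And>n. a (Suc n) \<le> (if good n then \<theta> else 1) * a n + (S (Suc n) - S n)"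
    and \<theta>: "0 \<le> \<theta>" "\<theta> < 1" and S: "mono S"
    and freq: "(\<lambda>n. real (card {q. q < n \<and> good q}) / real n) \<longlonglongrightarrow> p" and p: "p > 0"
    and drift: "\<And>l. l > 0 \<Longrightarrow> (\<lambda>n. S n - S (look_back l n)) \<longlonglongrightarrow> K * l"
  shows "a \<longlonglongrightarrow> 0"
proof (rule tendstoI)
  fix e :: real assume "e > 0"
  \<comment> \<open>The sign of \<open>K\<close> is not prescribed; \<open>\<bar>K\<bar> + 1\<close>
    is positive in any case and gives \<open>K * l < e\<close>.\<close>
  define l where "l = e / (2 * (\<bar>K\<bar> + 1))"
  have l: "l > 0" using \<open>e > 0\<close> by (simp add: l_def)
  have "K * l \<le> \<bar>K\<bar> * l" using l by (intro mult_right_mono) auto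
  also have "\<dots> < (\<bar>K\<bar> + 1) * l" using l by simp
  also have "\<dots> = e / 2" unfolding l_def by (simp add: field_simps)
  finally have Kl: "K * l < e" using \<open>e > 0\<close> by simp
  define G where "G n = card {q. q < n \<and> good q}" for n
  have G_Suc: "G (Suc n) = (if good n then Suc (G n) else G n)" for n
  proof -
    have "{q. q < Suc n \<and> good q} = (if good n then insert n {q. q < n \<and> good q} else {q. q < n \<and> good q})"
      by (auto simp: less_Suc_eq)
    thus ?thesis by (simp add: G_def)
  qed
  have G_mono: "mono G" by (rule incseq_SucI) (simp add: G_Suc)
  have B: "B \<ge> 0" using nonneg[of 0] bounded[of 0] by linarith
  have iter: "a n \<le> \<theta> ^ (G n - G m) * B + (S n - S m)" if "m \<le> n" for m n
    using that
  proof (induction n rule: dec_induct)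
    case base
    show ?case using bounded by simp
  next
    case (step n)
    have Smn: "S n - S m \<ge> 0" using monoD[OF S step(1)] by simp
    have Gmn: "G m \<le> G n" using monoD[OF G_mono step(1)] .
    have "a (Suc n) \<le> (if good n then \<theta> else 1) * a n + (S (Suc n) - S n)" by (rule assms)
    also have "\<dots> \<le> (if good n then \<theta> else 1) * (\<theta> ^ (G n - G m) * B + (S n - S m)) + (S (Suc n) - S n)"
      using step.IH \<theta> by (intro add_right_mono mult_left_mono[of "a n"]) auto
    also have "\<dots> = \<theta> ^ (G (Suc n) - G m) * B + (if good n then \<theta> else 1) * (S n - S m) + (S (Suc n) - S n)"
      using Gmn by (simp add: G_Suc Suc_diff_le algebra_simps)
    \<comment> \<open>Drift accumulated before a good index would be contracted too, but is kept in
      full so that the bound telescopes.\<close>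
    also have "\<dots> \<le> \<theta> ^ (G (Suc n) - G m) * B + 1 * (S n - S m) + (S (Suc n) - S n)"
      using \<theta> Smn B by (intro add_mono mult_right_mono) auto
    finally show ?case by simp
  qed
  have freqG: "(\<lambda>n. real (G n) / real n) \<longlonglongrightarrow> p" using freq by (simp add: G_def)
  \<comment> \<open>The number of good indices in the window, divided by \<open>n\<close>, tends to
    \<open>p * (1 - exp (- l))\<close>, which is positive.\<close>
  have "(\<lambda>n. real (G n) / real n - real (G (look_back l n)) / real (look_back l n) * (real (look_back l n) / real n))
      \<longlonglongrightarrow> p - p * exp (- l)"
    by (intro tendsto_intros freqG look_back_ratio filterlim_compose[OF freqG look_back_at_top])
  moreover have "p - p * exp (- l) > 0" using p l by simp
  ultimately have "filterlim (\<lambda>n. (real (G n) / real n - real (G (look_back l n)) / real (look_back l n)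
      * (real (look_back l n) / real n)) * real n) at_top sequentially"
    by (rule filterlim_tendsto_pos_mult_at_top[OF _ _ filterlim_real_sequentially])
  moreover have "\<forall>\<^sub>F n in sequentially. (real (G n) / real n - real (G (look_back l n)) / real (look_back l n)
      * (real (look_back l n) / real n)) * real n = real (G n - G (look_back l n))"
    using eventually_gt_at_top[of 0] eventually_compose_filterlim[OF eventually_gt_at_top[of 0] look_back_at_top[of l]]
  proof eventually_elim
    case (elim n)
    have "G (look_back l n) \<le> G n" using monoD[OF G_mono look_back_le[of l n]] l by simp
    thus ?case using elim by (simp add: left_diff_distrib of_nat_diff)
  qed
  ultimately have "filterlim (\<lambda>n. real (G n - G (look_back l n))) at_top sequentially"
    by (rule filterlim_cong[THEN iffD1, OF refl refl, rotated])
  hence "filterlim (\<lambda>n. G n - G (look_back l n)) at_top sequentially"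
    by (simp add: filterlim_sequentially_iff_filterlim_real)
  hence "(\<lambda>n. \<theta> ^ (G n - G (look_back l n))) \<longlonglongrightarrow> 0"
    by (rule filterlim_compose[OF LIMSEQ_realpow_zero[OF \<theta>]])
  hence "(\<lambda>n. \<theta> ^ (G n - G (look_back l n)) * B + (S n - S (look_back l n))) \<longlonglongrightarrow> 0 * B + K * l"
    by (intro tendsto_intros drift l)
  hence "\<forall>\<^sub>F n in sequentially. \<theta> ^ (G n - G (look_back l n)) * B + (S n - S (look_back l n)) < e"
    using Kl by (intro order_tendstoD(2)) auto
  thus "\<forall>\<^sub>F n in sequentially. dist (a n) 0 < e"
  proof eventually_elim
    case (elim n)
    have "look_back l n \<le> n" using l by (simp add: look_back_le)
    from iter[OF this] elim nonneg[of n] show ?case by (simp add: dist_real_def)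
  qed
qed

section \<open>Clocks of the players and spreading words\<close>

text \<open>Iteration \<open>k\<close> itself is excluded, unlike in \<open>update_count\<close>, so
  that time \<open>k\<close> refers to the state before that iteration.\<close>

definition num_updates :: "(nat \<Rightarrow> 'n \<times> 'n) \<Rightarrow> 'n \<Rightarrow> nat \<Rightarrow> nat" where
  "num_updates s i k = card {l. l < k \<and> fst (s l) = i}"

lemma update_count_eq: "update_count s k i = num_updates s i (Suc k)"
  by (simp add: update_count_def num_updates_def less_Suc_eq_le)

lemma num_updates_Suc:
  "num_updates s i (Suc k) = (if fst (s k) = i then Suc (num_updates s i k) else num_updates s i k)"
proof -
  have "{l. l < Suc k \<and> fst (s l) = i}
      = (if fst (s k) = i then insert k {l. l < k \<and> fst (s l) = i} else {l. l < k \<and> fst (s l) = i})"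
    by (auto simp: less_Suc_eq)
  thus ?thesis by (simp add: num_updates_def)
qed

text \<open>The sum of the steps \<open>1, 1/2, 1/3, ...\<close> that player \<open>i\<close> has
  used before iteration \<open>k\<close>.\<close>

definition clock :: "(nat \<Rightarrow> 'n \<times> 'n) \<Rightarrow> 'n \<Rightarrow> nat \<Rightarrow> real" where
  "clock s i k = harm (num_updates s i k)"

lemma clock_Suc:
  "clock s i (Suc k) = clock s i k + (if fst (s k) = i then step_size s k i else 0)"
  by (simp add: clock_def num_updates_Suc harm_Suc step_size_def update_count_eq inverse_eq_divide)

lemma step_size_nonneg: "step_size s k i \<ge> 0"
  by (simp add: step_size_def)

definition total_clock :: "(nat \<Rightarrow> 'n::finite \<times> 'n) \<Rightarrow> nat \<Rightarrow> real" where
  "total_clock s k = (\<Sum>i\<in>UNIV. clock s i k)"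

lemma total_clock_Suc: "total_clock s (Suc k) = total_clock s k + step_size s k (fst (s k))"
  by (simp add: total_clock_def clock_Suc sum.distrib)

lemma mono_total_clock: "mono (total_clock s)"
  by (rule incseq_SucI) (simp add: total_clock_Suc step_size_nonneg)

section \<open>Words of draws that spread information\<close>

text \<open>The players reached by information held in \<open>S\<close>: in a draw
  \<open>(i, j)\<close> player \<open>i\<close> averages with \<open>j\<close>, so information
  passes from the second component to the first.\<close>

definition spread :: "('n \<times> 'n) list \<Rightarrow> 'n set \<Rightarrow> 'n set" where
  "spread w S = fold (\<lambda>(i, j) S. if j \<in> S then insert i S else S) w S"

lemma spread_append: "spread (u @ w) S = spread w (spread u S)"
  by (simp add: spread_def)

lemma spread_snoc: "spread (w @ [e]) S =
    (if snd e \<in> spread w S then insert (fst e) (spread w S) else spread w S)"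
  by (simp add: spread_def case_prod_beta)

lemma spread_Nil [simp]: "spread [] S = S"
  by (simp add: spread_def)

lemma subset_spread: "S \<subseteq> spread w S"
  by (induction w rule: rev_induct) (auto simp: spread_snoc)

lemma spread_mono: "S \<subseteq> T \<Longrightarrow> spread w S \<subseteq> spread w T"
  by (induction w rule: rev_induct) (auto simp: spread_snoc)

text \<open>As long as some player is not reached, a directed path from \<open>j\<close> to her
  leaves the current set along some edge \<open>(a, b)\<close>, and the draw \<open>(b, a)\<close>
  enlarges the set.\<close>

lemma exists_spreading_word_from:
  fixes E :: "('n::finite \<times> 'n) set"
  assumes E: "strongly_connected_digraph E"
  shows "j \<in> S \<Longrightarrow> \<exists>w. set w \<subseteq> {(i, j). (j, i) \<in> E} \<and> spread w S = UNIV"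
proof (induction "card (- S)" arbitrary: S rule: less_induct)
  case less
  show ?case
  proof (cases "S = UNIV")
    case True
    thus ?thesis by (intro exI[of _ "[]"]) simp
  next
    case False
    then obtain v where v: "v \<notin> S" by auto
    have "(j, v) \<in> E\<^sup>*" using E by (simp add: strongly_connected_digraph_def)
    hence "\<exists>a b. (a, b) \<in> E \<and> a \<in> S \<and> b \<notin> S"
      using less.prems v by (induction rule: rtrancl_induct) auto
    then obtain a b where ab: "(a, b) \<in> E" "a \<in> S" "b \<notin> S" by blast
    have "card (- insert b S) < card (- S)"
      using ab by (intro psubset_card_mono) auto
    from less.hyps[OF this] less.prems obtain w
      where w: "set w \<subseteq> {(i, j). (j, i) \<in> E}" "spread w (insert b S) = UNIV" by auto
    have "spread ([(b, a)] @ w) S = UNIV"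
      unfolding spread_append using ab w by (simp add: spread_def)
    thus ?thesis using w ab by (intro exI[of _ "[(b, a)] @ w"]) auto
  qed
qed

text \<open>Words for the single sources are concatenated. A prefix or a suffix does no harm, since
  \<open>spread\<close> is monotone and never loses a player.\<close>

lemma exists_spreading_word:
  fixes E :: "('n::finite \<times> 'n) set"
  assumes E: "strongly_connected_digraph E"
  shows "\<exists>w. set w \<subseteq> {(i, j). (j, i) \<in> E} \<and> (\<forall>j. spread w {j} = UNIV)"
proof -
  have "\<exists>w. set w \<subseteq> {(i, j). (j, i) \<in> E} \<and> (\<forall>j\<in>A. spread w {j} = UNIV)" if "finite A" for A :: "'n set"
    using that
  proof (induction rule: finite_induct)
    case empty
    show ?case by (intro exI[of _ "[]"]) auto
  next
    case (insert a A)
    then obtain w where w: "set w \<subseteq> {(i, j). (j, i) \<in> E}" "\<forall>j\<in>A. spread w {j} = UNIV" by blast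
    obtain u where u: "set u \<subseteq> {(i, j). (j, i) \<in> E}" "spread u {a} = UNIV"
      using exists_spreading_word_from[OF E, of a "{a}"] by auto
    have "spread (w @ u) {a} = UNIV"
      using spread_mono[OF subset_spread[of "{a}" w], of u] u by (auto simp: spread_append)
    moreover have "spread (w @ u) {j} = UNIV" if "j \<in> A" for j
      using w that subset_spread[of UNIV u] by (auto simp: spread_append)
    ultimately show ?case using w u by (intro exI[of _ "w @ u"]) auto
  qed
  from this[OF finite[of "UNIV :: 'n set"]] show ?thesis by simp
qed

section \<open>Contraction of errors by averaging\<close>

text \<open>Here \<open>d k l\<close> is the error of player \<open>l\<close>, \<open>T\<close> the
  set of exact players and \<open>S\<close> the accumulated drift. A reached player is better than
  \<open>B\<close> by a fraction \<open>1 / 2 ^ t\<close>; averaging with an arbitrary player at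
  worst halves this advantage. The bound for all players enters the induction as the bound on the
  partner.\<close>

lemma averaging_contraction:
  fixes d :: "nat \<Rightarrow> 'n \<Rightarrow> real"
  assumes step: "\<And>k l. d (Suc k) l \<le>
        (if l = fst (s k) then (d k l + d k (snd (s k))) / 2 else d k l) + (S (Suc k) - S k)"
    and S: "mono S"
    and B: "\<And>l. d k l \<le> B" "B \<ge> 0" and T: "\<And>l. l \<in> T \<Longrightarrow> d k l \<le> 0"
  shows "d (k + t) l \<le> B + (S (k + t) - S k)"
    and "l \<in> spread (map s [k..<k + t]) T \<Longrightarrow> d (k + t) l \<le> (1 - 1 / 2 ^ t) * B + (S (k + t) - S k)"
proof -
  have "(\<forall>l. d (k + t) l \<le> B + (S (k + t) - S k)) \<and>
        (\<forall>l\<in>spread (map s [k..<k + t]) T. d (k + t) l \<le> (1 - 1 / 2 ^ t) * B + (S (k + t) - S k))"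
  proof (induction t)
    case 0
    show ?case using B T by simp
  next
    case (Suc t)
    let ?i = "fst (s (k + t))" and ?j = "snd (s (k + t))" and ?R = "spread (map s [k..<k + t]) T"
    define \<theta> where "\<theta> = (1 - 1 / 2 ^ t) * B"
    define \<delta> where "\<delta> = S (Suc (k + t)) - S (k + t)"
    define \<Delta> where "\<Delta> = S (k + t) - S k"
    have all: "d (k + t) l \<le> B + \<Delta>" for l using Suc by (simp add: \<Delta>_def)
    have reached: "d (k + t) l \<le> \<theta> + \<Delta>" if "l \<in> ?R" for l
      using Suc that by (simp add: \<theta>_def \<Delta>_def)
    have sum: "S (Suc (k + t)) - S k = \<Delta> + \<delta>" by (simp add: \<Delta>_def \<delta>_def)
    have half: "(1 - 1 / 2 ^ Suc t) * B = (\<theta> + B) / 2"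
      by (simp add: \<theta>_def field_simps)
    have "\<theta> \<le> 1 * B" unfolding \<theta>_def using B by (intro mult_right_mono) auto
    \<comment> \<open>A reached player who is not drawn keeps her bound, which is stronger than the
      one required after the next iteration.\<close>
    hence weaker: "2 * \<theta> \<le> \<theta> + B" by simp
    have avg: "2 * d (Suc (k + t)) l \<le> d (k + t) l + d (k + t) ?j + 2 * \<delta>" if "l = ?i" for l
      using step[of "k + t" l] that by (simp add: \<delta>_def field_simps)
    have keep: "d (Suc (k + t)) l \<le> d (k + t) l + \<delta>" if "l \<noteq> ?i" for l
      using step[of "k + t" l] that by (simp add: \<delta>_def)
    have all': "d (Suc (k + t)) l \<le> B + (\<Delta> + \<delta>)" for l
    proof (cases "l = ?i")
      case True
      show ?thesis using avg[OF True] all[of l] all[of ?j] by simp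
    next
      case False
      show ?thesis using keep[OF False] all[of l] by simp
    qed
    have twice: "2 * d (Suc (k + t)) l \<le> (\<theta> + B) + 2 * (\<Delta> + \<delta>)"
      if l: "l \<in> spread (map s [k..<k + Suc t]) T" for l
    proof -
      \<comment> \<open>Whether \<open>l\<close> was reached before or is reached now, if she is
        drawn then at least one of the two averaged errors belongs to a reached player.\<close>
      have l: "l \<in> ?R \<or> l = ?i \<and> ?j \<in> ?R"
        using l by (auto simp: spread_snoc split: if_splits)
      show ?thesis
      proof (cases "l = ?i")
        case True
        from l consider "l \<in> ?R" | "?j \<in> ?R" by blast
        thus ?thesis
        proof cases
          case 1
          show ?thesis using avg[OF True] reached[OF 1] all[of ?j] by simp
        next
          case 2
          show ?thesis using avg[OF True] reached[OF 2] all[of l] by simp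
        qed
      next
        case False
        hence "l \<in> ?R" using l by blast
        from keep[OF False] reached[OF this] weaker show ?thesis by simp
      qed
    qed
    have "d (Suc (k + t)) l \<le> (\<theta> + B) / 2 + (\<Delta> + \<delta>)"
      if "l \<in> spread (map s [k..<k + Suc t]) T" for l
      using twice[OF that] by (simp add: field_simps)
    with all' have "(\<forall>l. d (Suc (k + t)) l \<le> B + (S (Suc (k + t)) - S k)) \<and>
        (\<forall>l\<in>spread (map s [k..<k + Suc t]) T.
           d (Suc (k + t)) l \<le> (1 - 1 / 2 ^ Suc t) * B + (S (Suc (k + t)) - S k))"
      unfolding sum half by blast
    thus ?case unfolding add_Suc_right .
  qed
  thus "d (k + t) l \<le> B + (S (k + t) - S k)"
    and "l \<in> spread (map s [k..<k + t]) T \<Longrightarrow> d (k + t) l \<le> (1 - 1 / 2 ^ t) * B + (S (k + t) - S k)"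
    by blast+
qed

text \<open>This gives positive probability to every word spelled by draws along edges.\<close>

lemma in_neighbours_set_pmf:
  "{(i, j). (j, i) \<in> E} \<subseteq> set_pmf (gossip_pmf E)" for E :: "('n::finite \<times> 'n) set"
proof clarify
  fix i j assume "(j, i) \<in> E"
  hence "in_neighbours E i \<noteq> {}" "j \<in> in_neighbours E i" by (auto simp: in_neighbours_def)
  thus "(i, j) \<in> set_pmf (gossip_pmf E)"
    by (simp add: gossip_pmf_def set_pmf_of_set)
qed

lemma map_fst_gossip_pmf: "map_pmf fst (gossip_pmf E) = pmf_of_set UNIV"
  by (simp add: gossip_pmf_def map_bind_pmf bind_return_pmf' bind_pmf_const)

section \<open>The game\<close>

lemma gossip_matrix_mult_row:
  "(gossip_matrix i j ** X) $ l = (if l = i then (1/2) *\<^sub>R (X $ i + X $ j) else X $ l)"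
proof -
  have entry: "gossip_matrix i j $ l $ m = (if l = m then 1 else 0)
      - (if l = i then ((if m = i then 1 else 0) - (if m = j then 1 else 0)) / 2 else 0)" for m
    by (auto simp: gossip_matrix_def matrix_matrix_mult_def columnvector_def rowvector_def mat_def axis_def)
  have "(gossip_matrix i j ** X) $ l $ c = (if l = i then (X $ i $ c + X $ j $ c) / 2 else X $ l $ c)" for c
  proof -
    have "(gossip_matrix i j ** X) $ l $ c = (\<Sum>m\<in>UNIV. gossip_matrix i j $ l $ m * X $ m $ c)"
      by (simp add: matrix_matrix_mult_def)
    also have "\<dots> = (\<Sum>m\<in>UNIV. (if l = m then X $ m $ c else 0)
        - (if l = i then ((if m = i then X $ m $ c else 0) - (if m = j then X $ m $ c else 0)) / 2 else 0))"
      by (intro sum.cong) (auto simp: entry algebra_simps)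
    also have "\<dots> = X $ l $ c - (if l = i then (X $ i $ c - X $ j $ c) / 2 else 0)"
      by (simp add: sum_subtractf sum.delta sum.delta' flip: sum_divide_distrib)
    finally show ?thesis by (auto simp: field_simps)
  qed
  thus ?thesis by (simp add: vec_eq_iff)
qed

locale game =
  fixes \<Omega> :: "'n::finite \<Rightarrow> real set"
    and J :: "'n \<Rightarrow> real ^ 'n \<Rightarrow> real"
    and \<sigma> L :: "'n \<Rightarrow> real"
    and xstar :: "real ^ 'n"
  assumes action_sets: "\<And>i. \<Omega> i \<noteq> {} \<and> compact (\<Omega> i) \<and> convex (\<Omega> i)"
    and cost_C1: "\<And>i. C1_in_own_action \<Omega> J i"
    and strictly_monotone: "strictly_monotone_on (profiles \<Omega>) (pseudo_gradient \<Omega> J)"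
    and lipschitz_consts: "\<And>i. \<sigma> i > 0 \<and> L i > 0"
    and lipschitz_own: "\<And>i x. x \<in> profiles \<Omega> \<Longrightarrow>
          (\<sigma> i)-lipschitz_on (\<Omega> i) (\<lambda>t. own_gradient \<Omega> J i (with_action x i t))"
    and lipschitz_others: "\<And>i t. t \<in> \<Omega> i \<Longrightarrow>
          (L i)-lipschitz_on {x \<in> profiles \<Omega>. x $ i = t} (own_gradient \<Omega> J i)"
    and nash: "nash_equilibrium \<Omega> J xstar"
begin

lemma closed_action_set: "closed (\<Omega> i)"
  using action_sets compact_imp_closed by blast

lemma xstar_profile: "xstar \<in> profiles \<Omega>"
  using nash by (simp add: nash_equilibrium_def)

lemma compact_profiles: "compact (profiles \<Omega>)"
proof -
  have "\<exists>b. \<forall>t\<in>\<Omega> i. \<bar>t\<bar> \<le> b" for i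
    using compact_imp_bounded[of "\<Omega> i"] action_sets[of i] by (auto simp: bounded_iff)
  then obtain b where b: "\<And>i t. t \<in> \<Omega> i \<Longrightarrow> \<bar>t\<bar> \<le> b i" by metis
  have "norm x \<le> (\<Sum>i\<in>UNIV. b i)" if "x \<in> profiles \<Omega>" for x
    using that b by (intro order.trans[OF norm_le_l1_cart] sum_mono) (auto simp: profiles_def)
  hence "bounded (profiles \<Omega>)" by (auto simp: bounded_iff)
  moreover have "closed (profiles \<Omega>)"
  proof -
    have "profiles \<Omega> = (\<Inter>i. (\<lambda>x. x $ i) -` \<Omega> i)" by (auto simp: profiles_def)
    moreover have "closed ((\<lambda>x::real^'n. x $ i) -` \<Omega> i)" for i
      by (intro closed_vimage closed_action_set continuous_intros)
    ultimately show ?thesis by auto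
  qed
  ultimately show ?thesis by (simp add: compact_eq_bounded_closed)
qed

section \<open>Uniform constants for the gradients\<close>

text \<open>Summing over the players yields one constant that dominates every
  \<open>\<sigma> i + L i\<close>.\<close>

definition lip :: real where "lip = (\<Sum>i\<in>UNIV. \<sigma> i + L i)"

lemma lip_nonneg: "lip \<ge> 0"
  unfolding lip_def using lipschitz_consts by (intro sum_nonneg) (simp add: less_imp_le)

text \<open>The passage from \<open>x\<close> to \<open>y\<close> goes through \<open>z\<close>,
  which has the own action of \<open>x\<close> and the other actions of \<open>y\<close>; each leg
  is covered by one of the two separate Lipschitz conditions.\<close>

lemma own_gradient_lipschitz:
  assumes x: "x \<in> profiles \<Omega>" and y: "y \<in> profiles \<Omega>"
  shows "\<bar>own_gradient \<Omega> J i x - own_gradient \<Omega> J i y\<bar> \<le> lip * norm (x - y)"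
proof -
  define z where "z = with_action y i (x $ i)"
  have z: "z \<in> profiles \<Omega>" "z $ i = x $ i" using x y by (auto simp: z_def profiles_def with_action_def)
  have y_eq: "y = with_action y i (y $ i)" by (simp add: with_action_def vec_eq_iff)
  have "dist (own_gradient \<Omega> J i z) (own_gradient \<Omega> J i y) \<le> \<sigma> i * dist (x $ i) (y $ i)"
    using lipschitz_onD[OF lipschitz_own[OF y, of i], of "x $ i" "y $ i"] x y y_eq
    by (simp add: z_def profiles_def)
  also have "\<dots> \<le> \<sigma> i * norm (x - y)"
    using component_le_norm_cart[of "x - y" i] lipschitz_consts[of i]
    by (intro mult_left_mono) (auto simp: dist_real_def)
  finally have 1: "\<bar>own_gradient \<Omega> J i z - own_gradient \<Omega> J i y\<bar> \<le> \<sigma> i * norm (x - y)"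
    by (simp add: dist_real_def)
  have "dist (own_gradient \<Omega> J i x) (own_gradient \<Omega> J i z) \<le> L i * dist x z"
    by (rule lipschitz_onD[OF lipschitz_others[of "x $ i"]]) (use x z in \<open>auto simp: profiles_def\<close>)
  also have "\<dots> \<le> L i * norm (x - y)"
    using lipschitz_consts[of i] unfolding dist_norm
    by (intro mult_left_mono norm_le_componentwise_cart) (auto simp: z_def with_action_def)
  finally have 2: "\<bar>own_gradient \<Omega> J i x - own_gradient \<Omega> J i z\<bar> \<le> L i * norm (x - y)"
    by (simp add: dist_real_def)
  have "\<sigma> i + L i \<le> lip"
    unfolding lip_def using lipschitz_consts by (intro member_le_sum) (auto simp: less_imp_le add_nonneg_nonneg)
  hence "(\<sigma> i + L i) * norm (x - y) \<le> lip * norm (x - y)" by (rule mult_right_mono) simp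
  with 1 2 show ?thesis by (simp add: algebra_simps)
qed

lemma continuous_on_own_gradient: "continuous_on (profiles \<Omega>) (own_gradient \<Omega> J i)"
  by (rule lipschitz_on_continuous_on[of lip])
     (auto intro!: lipschitz_onI own_gradient_lipschitz lip_nonneg simp: dist_norm)

definition diam :: real where "diam = diameter (profiles \<Omega>)"

lemma norm_diff_le_diam:
  assumes "x \<in> profiles \<Omega>" "y \<in> profiles \<Omega>"
  shows "norm (x - y) \<le> diam"
  using diameter_bounded_bound[OF compact_imp_bounded[OF compact_profiles] assms]
  by (simp add: diam_def dist_norm)

lemma diam_nonneg: "diam \<ge> 0"
  using norm_diff_le_diam[OF xstar_profile xstar_profile] by simp

definition grad_bound :: real where
  "grad_bound = (\<Sum>i\<in>UNIV. \<bar>own_gradient \<Omega> J i xstar\<bar>) + lip * diam"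

lemma own_gradient_bound:
  assumes x: "x \<in> profiles \<Omega>"
  shows "\<bar>own_gradient \<Omega> J i x\<bar> \<le> grad_bound"
proof -
  have "\<bar>own_gradient \<Omega> J i x - own_gradient \<Omega> J i xstar\<bar> \<le> lip * diam"
    using own_gradient_lipschitz[OF x xstar_profile, of i]
      mult_left_mono[OF norm_diff_le_diam[OF x xstar_profile] lip_nonneg] by linarith
  moreover have "\<bar>own_gradient \<Omega> J i xstar\<bar> \<le> (\<Sum>i\<in>UNIV. \<bar>own_gradient \<Omega> J i xstar\<bar>)"
    by (rule member_le_sum) auto
  ultimately show ?thesis by (simp add: grad_bound_def)
qed

lemma grad_bound_nonneg: "grad_bound \<ge> 0"
  using own_gradient_bound[OF xstar_profile] by (meson abs_ge_zero order.trans)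

section \<open>First-order optimality and strict descent\<close>

text \<open>Otherwise a small move from the equilibrium action towards \<open>t\<close>, which stays
  in the convex action set, would lower the cost of player \<open>i\<close>.\<close>

lemma variational_inequality:
  assumes t: "t \<in> \<Omega> i"
  shows "own_gradient \<Omega> J i xstar * (t - xstar $ i) \<ge> 0"
proof (rule ccontr)
  let ?h = "\<lambda>t. J i (with_action xstar i t)" and ?D = "own_gradient \<Omega> J i xstar" and ?a = "xstar $ i"
  assume "\<not> ?D * (t - ?a) \<ge> 0"
  hence neg: "?D * (t - ?a) < 0" by simp
  have a: "?a \<in> \<Omega> i" using xstar_profile by (simp add: profiles_def)
  have "?h differentiable (at ?a within \<Omega> i)"
    using cost_C1[of i] xstar_profile a by (auto simp: C1_in_own_action_def differentiable_on_def)
  hence "(?h has_vector_derivative ?D) (at ?a within \<Omega> i)"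
    unfolding own_gradient_def by (rule vector_derivative_works[THEN iffD1])
  hence deriv: "(?h has_real_derivative ?D) (at ?a within \<Omega> i)"
    by (simp add: has_real_derivative_iff_has_vector_derivative)
  have ge: "?h ?a \<le> ?h r" if "r \<in> \<Omega> i" for r
  proof -
    have "xstar = with_action xstar i ?a" by (simp add: with_action_def vec_eq_iff)
    thus ?thesis using nash that by (simp add: nash_equilibrium_def)
  qed
  have between: "closed_segment ?a t \<subseteq> \<Omega> i"
    using closed_segment_subset[OF a t] action_sets by blast
  show False
  proof (cases "t > ?a")
    case True
    with neg have "?D < 0" by (simp add: mult_less_0_iff)
    from has_real_derivative_neg_dec_right[OF deriv this] obtain d where
      d: "d > 0" "\<And>h. h > 0 \<Longrightarrow> ?a + h \<in> \<Omega> i \<Longrightarrow> h < d \<Longrightarrow> ?h (?a + h) < ?h ?a" by auto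
    \<comment> \<open>Small enough for the sign of the derivative to decide, and not beyond
      \<open>t\<close>.\<close>
    define h where "h = min (d / 2) (t - ?a)"
    have h: "h > 0" "h < d" "?a + h \<in> closed_segment ?a t"
      using True d(1) by (auto simp: h_def closed_segment_eq_real_ivl)
    hence "?a + h \<in> \<Omega> i" using between by blast
    from d(2)[OF h(1) this h(2)] ge[OF this] show False by simp
  next
    case False
    with neg have "t < ?a" "?D > 0" by (auto simp: mult_less_0_iff)
    from has_real_derivative_pos_inc_left[OF deriv this(2)] obtain d where
      d: "d > 0" "\<And>h. h > 0 \<Longrightarrow> ?a - h \<in> \<Omega> i \<Longrightarrow> h < d \<Longrightarrow> ?h (?a - h) < ?h ?a" by auto
    define h where "h = min (d / 2) (?a - t)"
    have h: "h > 0" "h < d" "?a - h \<in> closed_segment ?a t"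
      using \<open>t < ?a\<close> d(1) by (auto simp: h_def closed_segment_eq_real_ivl)
    hence "?a - h \<in> \<Omega> i" using between by blast
    from d(2)[OF h(1) this h(2)] ge[OF this] show False by simp
  qed
qed

text \<open>The \<open>i\<close>-th summand of the inner product of the pseudo-gradient with
  \<open>x - xstar\<close>: to first order, a step of player \<open>i\<close> lowers the squared
  distance to \<open>xstar\<close> by twice this amount per unit of step size.\<close>

definition descent :: "'n \<Rightarrow> real ^ 'n \<Rightarrow> real" where
  "descent i x = own_gradient \<Omega> J i x * (x $ i - xstar $ i)"

lemma descent_lipschitz:
  assumes x: "x \<in> profiles \<Omega>" and y: "y \<in> profiles \<Omega>"
  shows "\<bar>descent i x - descent i y\<bar> \<le> (lip * diam + grad_bound) * norm (x - y)"
proof -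
  let ?g = "own_gradient \<Omega> J i"
  have "descent i x - descent i y = (?g x - ?g y) * (x - xstar) $ i + ?g y * (x - y) $ i"
    by (simp add: descent_def algebra_simps)
  also have "\<bar>\<dots>\<bar> \<le> \<bar>?g x - ?g y\<bar> * \<bar>(x - xstar) $ i\<bar> + \<bar>?g y\<bar> * \<bar>(x - y) $ i\<bar>"
    by (metis abs_mult abs_triangle_ineq)
  also have "\<dots> \<le> (lip * norm (x - y)) * diam + grad_bound * norm (x - y)"
    using own_gradient_lipschitz[OF x y, of i] own_gradient_bound[OF y, of i]
      norm_diff_le_diam[OF x xstar_profile] lip_nonneg grad_bound_nonneg
      component_le_norm_cart[of "x - xstar" i] component_le_norm_cart[of "x - y" i]
    by (intro add_mono mult_mono) auto
  finally show ?thesis by (simp add: algebra_simps)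
qed

lemma descent_bound:
  assumes x: "x \<in> profiles \<Omega>"
  shows "\<bar>descent i x\<bar> \<le> grad_bound * diam"
  unfolding descent_def abs_mult
  using own_gradient_bound[OF x, of i] norm_diff_le_diam[OF x xstar_profile] grad_bound_nonneg
    component_le_norm_cart[of "x - xstar" i]
  by (intro mult_mono) auto

text \<open>The terms with the gradient at \<open>xstar\<close> are nonnegative by the variational
  inequality, so dropping them only increases the sum.\<close>

lemma descent_sum_ge:
  assumes x: "x \<in> profiles \<Omega>"
  shows "(pseudo_gradient \<Omega> J x - pseudo_gradient \<Omega> J xstar) \<bullet> (x - xstar) \<le> (\<Sum>i\<in>UNIV. descent i x)"
proof -
  have "(pseudo_gradient \<Omega> J x - pseudo_gradient \<Omega> J xstar) \<bullet> (x - xstar)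
      = (\<Sum>i\<in>UNIV. descent i x - own_gradient \<Omega> J i xstar * (x $ i - xstar $ i))"
    by (simp add: inner_vec_def pseudo_gradient_def descent_def algebra_simps)
  also have "\<dots> \<le> (\<Sum>i\<in>UNIV. descent i x)"
    using variational_inequality x by (intro sum_mono) (auto simp: profiles_def)
  finally show ?thesis .
qed

text \<open>The sum is continuous, so it attains its minimum on the compact set of profiles away
  from \<open>xstar\<close>; strict monotonicity makes that minimum positive.\<close>

lemma descent_sum_pos:
  assumes "e > 0"
  obtains c where "c > 0" "\<And>x. x \<in> profiles \<Omega> \<Longrightarrow> (norm (x - xstar))\<^sup>2 \<ge> e \<Longrightarrow> (\<Sum>i\<in>UNIV. descent i x) \<ge> c"
proof (cases "\<exists>x\<in>profiles \<Omega>. (norm (x - xstar))\<^sup>2 \<ge> e")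
  case True
  let ?K = "profiles \<Omega> \<inter> {x. (norm (x - xstar))\<^sup>2 \<ge> e}"
  have "compact ?K"
    by (intro compact_Int_closed compact_profiles closed_Collect_le continuous_intros)
  moreover have "?K \<noteq> {}" using True by blast
  moreover have "continuous_on ?K (\<lambda>x. \<Sum>i\<in>UNIV. descent i x)"
    unfolding descent_def
    by (intro continuous_intros continuous_on_subset[OF continuous_on_own_gradient]) auto
  ultimately obtain y where y: "y \<in> ?K"
    "\<And>x. x \<in> ?K \<Longrightarrow> (\<Sum>i\<in>UNIV. descent i y) \<le> (\<Sum>i\<in>UNIV. descent i x)"
    using continuous_attains_inf[of ?K] by metis
  have "y \<noteq> xstar" using y assms by auto
  hence "(pseudo_gradient \<Omega> J y - pseudo_gradient \<Omega> J xstar) \<bullet> (y - xstar) > 0"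
    using strictly_monotone y xstar_profile by (auto simp: strictly_monotone_on_def)
  hence "(\<Sum>i\<in>UNIV. descent i y) > 0" using descent_sum_ge[of y] y by auto
  thus ?thesis using that y by auto
next
  case False
  \<comment> \<open>No profile is that far from \<open>xstar\<close>, so any positive constant
    serves.\<close>
  thus ?thesis using that[of 1] by force
qed

end

section \<open>The algorithm on a fixed path of draws\<close>

lemma abs_average_le: "\<bar>(a + b) / 2\<bar> \<le> (\<bar>a\<bar> + \<bar>b\<bar>) / 2" for a b :: real
  using abs_triangle_ineq[of a b] by (simp add: abs_divide)

text \<open>The sequence \<open>s\<close> is arbitrary: the estimates in this context hold on every
  path of draws.\<close>

locale gossip_run = game \<Omega> J \<sigma> L xstar
  for \<Omega> :: "'n::finite \<Rightarrow> real set" and J \<sigma> L xstar +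
  fixes X0 :: "real ^ 'n ^ 'n" and s :: "nat \<Rightarrow> 'n \<times> 'n"
  assumes initial: "\<And>l. X0 $ l \<in> profiles \<Omega>"
begin

definition x :: "nat \<Rightarrow> real ^ 'n" where "x = actions \<Omega> J X0 s"

definition X :: "nat \<Rightarrow> real ^ 'n ^ 'n" where "X k = snd (gossip_state \<Omega> J X0 s k)"

definition \<alpha> :: "nat \<Rightarrow> real" where "\<alpha> k = step_size s k (fst (s k))"

text \<open>The profile at which the drawn player evaluates her gradient; its distance from
  \<open>x k\<close> is the effect of incomplete information.\<close>

definition gradient_point :: "nat \<Rightarrow> real ^ 'n" where
  "gradient_point k =
     with_action ((1/2) *\<^sub>R (X k $ fst (s k) + X k $ snd (s k))) (fst (s k)) (x k $ fst (s k))"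

definition grad :: "nat \<Rightarrow> real" where
  "grad k = own_gradient \<Omega> J (fst (s k)) (gradient_point k)"

lemma \<alpha>_nonneg: "\<alpha> k \<ge> 0"
  by (simp add: \<alpha>_def step_size_nonneg)

lemma state: "gossip_state \<Omega> J X0 s k = (x k, X k)"
  by (simp add: x_def X_def actions_def)

lemma x_0: "x 0 = (\<chi> i. X0 $ i $ i)" and X_0: "X 0 = X0"
  by (simp_all add: x_def X_def actions_def)

lemmas state_Suc = gossip_state.simps(2)[of \<Omega> J X0 s, unfolded state Let_def case_prod_beta fst_conv snd_conv]

lemma x_Suc: "x (Suc k) = with_action (x k) (fst (s k))
    (closest_point (\<Omega> (fst (s k))) (x k $ fst (s k) - \<alpha> k * grad k))"
  using state_Suc[of k]
  by (simp add: grad_def gradient_point_def \<alpha>_def gossip_matrix_mult_row)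

lemma X_Suc_raw: "X (Suc k) $ l $ c = (gossip_matrix (fst (s k)) (snd (s k)) ** X k) $ l $ c
    + (if c = l then x (Suc k) $ l - (gossip_matrix (fst (s k)) (snd (s k)) ** X k) $ l $ l else 0)"
proof -
  have "X (Suc k) = (\<chi> l. (gossip_matrix (fst (s k)) (snd (s k)) ** X k) $ l
      + (x (Suc k) $ l - (gossip_matrix (fst (s k)) (snd (s k)) ** X k) $ l $ l) *\<^sub>R axis l 1)"
    using state_Suc[of k] by simp
  thus ?thesis by (simp add: axis_def)
qed

text \<open>The correction along \<open>axis l 1\<close> overwrites the diagonal entry. Being exact
  about herself, player \<open>l\<close> is the source from which knowledge of her action
  spreads.\<close>

lemma diagonal: "X k $ l $ l = x k $ l"
  by (cases k) (simp_all add: x_0 X_0 X_Suc_raw)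

text \<open>For a player who is not drawn the correction vanishes: by \<open>diagonal\<close> her
  entry already equals her unchanged action.\<close>

lemma X_Suc: "X (Suc k) $ l $ c = (if l = fst (s k) then
      (if c = l then x (Suc k) $ l else (X k $ l $ c + X k $ snd (s k) $ c) / 2) else X k $ l $ c)"
  by (auto simp: X_Suc_raw gossip_matrix_mult_row diagonal x_Suc with_action_def)

lemma average_in_action_set:
  assumes "a \<in> \<Omega> i" "b \<in> \<Omega> i"
  shows "(a + b) / 2 \<in> \<Omega> i"
proof -
  have "(1 - 1/2) *\<^sub>R a + (1/2) *\<^sub>R b \<in> \<Omega> i"
    using action_sets[of i] assms by (intro convexD_alt) auto
  moreover have "(1 - 1/2) *\<^sub>R a + (1/2) *\<^sub>R b = (a + b) / 2" by (simp add: field_simps)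
  ultimately show ?thesis by (simp only:)
qed

lemma closest_point_in_action_set: "closest_point (\<Omega> i) t \<in> \<Omega> i"
  using closest_point_in_set[OF closed_action_set] action_sets by simp

lemma X_profile: "X k $ l \<in> profiles \<Omega>"
proof (induction k arbitrary: l)
  case 0
  show ?case by (simp add: X_0 initial)
next
  case (Suc k)
  have in_set: "X k $ l $ c \<in> \<Omega> c" for l c using Suc[of l] by (simp add: profiles_def)
  hence x_in: "x k $ c \<in> \<Omega> c" for c by (metis diagonal)
  have "x (Suc k) $ c \<in> \<Omega> c" for c
    using x_in by (simp add: x_Suc with_action_def closest_point_in_action_set)
  hence "X (Suc k) $ l $ c \<in> \<Omega> c" for c
    using in_set average_in_action_set[OF in_set in_set] by (simp add: X_Suc)
  thus ?case by (simp add: profiles_def)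
qed

lemma x_profile: "x k \<in> profiles \<Omega>"
  using X_profile[of k] by (auto simp: profiles_def diagonal[symmetric])

lemma gradient_point_profile: "gradient_point k \<in> profiles \<Omega>"
proof -
  have "gradient_point k $ c \<in> \<Omega> c" for c
  proof (cases "c = fst (s k)")
    case True
    thus ?thesis using x_profile[of k] by (simp add: gradient_point_def with_action_def profiles_def)
  next
    case False
    have "(X k $ fst (s k) $ c + X k $ snd (s k) $ c) / 2 \<in> \<Omega> c"
      by (intro average_in_action_set) (use X_profile[of k] in \<open>simp_all add: profiles_def\<close>)
    thus ?thesis using False by (simp add: gradient_point_def with_action_def)
  qed
  thus ?thesis by (simp add: profiles_def)
qed

lemma grad_le: "\<bar>grad k\<bar> \<le> grad_bound"
  unfolding grad_def by (rule own_gradient_bound[OF gradient_point_profile])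

text \<open>The projection is nonexpansive and fixes \<open>t\<close>. With \<open>t\<close> the
  current action this bounds the movement; with \<open>t\<close> the equilibrium action it gives the
  descent of the squared distance.\<close>

lemma projected_step:
  fixes t :: real
  assumes "t \<in> \<Omega> (fst (s k))"
  shows "\<bar>x (Suc k) $ fst (s k) - t\<bar> \<le> \<bar>x k $ fst (s k) - \<alpha> k * grad k - t\<bar>"
  using closest_point_lipschitz[of "\<Omega> (fst (s k))" "x k $ fst (s k) - \<alpha> k * grad k" t]
    closest_point_self[OF assms] closed_action_set action_sets
  by (simp add: x_Suc with_action_def dist_real_def)

lemma x_step: "norm (x (Suc k) - x k) \<le> grad_bound * \<alpha> k"
proof -
  let ?i = "fst (s k)"
  have "x k $ ?i \<in> \<Omega> ?i" using x_profile by (simp add: profiles_def)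
  from projected_step[OF this] have "\<bar>x (Suc k) $ ?i - x k $ ?i\<bar> \<le> \<bar>\<alpha> k * grad k\<bar>" by simp
  also have "\<dots> \<le> grad_bound * \<alpha> k"
    using mult_right_mono[OF grad_le \<alpha>_nonneg, of k k] \<alpha>_nonneg by (simp add: abs_mult mult.commute)
  moreover have "x (Suc k) - x k = axis ?i (x (Suc k) $ ?i - x k $ ?i)"
    by (simp add: vec_eq_iff axis_def x_Suc with_action_def)
  ultimately show ?thesis by (simp add: norm_eq_sqrt_inner inner_axis_axis)
qed

lemma x_window:
  assumes "m \<le> n"
  shows "norm (x n - x m) \<le> grad_bound * (total_clock s n - total_clock s m)"
  using assms
proof (induction n rule: dec_induct)
  case (step n)
  have "norm (x (Suc n) - x m) \<le> norm (x (Suc n) - x n) + norm (x n - x m)"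
    using norm_triangle_ineq[of "x (Suc n) - x n" "x n - x m"] by simp
  thus ?case using step x_step[of n] by (simp add: total_clock_Suc \<alpha>_def algebra_simps)
qed simp

section \<open>The estimation error\<close>

text \<open>The maximum norm is chosen because averaging two estimates cannot increase it.\<close>

definition err :: "nat \<Rightarrow> real" where
  "err k = Max (range (\<lambda>(l, c). \<bar>X k $ l $ c - x k $ c\<bar>))"

lemma err_ge: "\<bar>X k $ l $ c - x k $ c\<bar> \<le> err k"
  unfolding err_def by (rule Max_ge, simp, rule image_eqI[of _ _ "(l, c)"]) simp_all

lemma err_leI: "(\<And>l c. \<bar>X k $ l $ c - x k $ c\<bar> \<le> b) \<Longrightarrow> err k \<le> b"
  unfolding err_def by (subst Max_le_iff) auto

lemma err_nonneg: "err k \<ge> 0"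
  by (rule order.trans[OF abs_ge_zero err_ge])

lemma err_le_diam: "err k \<le> diam"
proof (rule err_leI)
  show "\<bar>X k $ l $ c - x k $ c\<bar> \<le> diam" for l c
    using order.trans[OF component_le_norm_cart[of "X k $ l - x k" c] norm_diff_le_diam[OF X_profile x_profile]]
    by simp
qed

text \<open>Only the drawn player's action moves, by at most \<open>grad_bound * \<alpha> k\<close>.
  This is written as an increment of \<open>grad_bound * total_clock s\<close> to match the drift in
  \<open>averaging_contraction\<close>.\<close>

lemma error_recursion:
  "\<bar>X (Suc k) $ l $ c - x (Suc k) $ c\<bar> \<le>
     (if l = fst (s k) then (\<bar>X k $ l $ c - x k $ c\<bar> + \<bar>X k $ snd (s k) $ c - x k $ c\<bar>) / 2
      else \<bar>X k $ l $ c - x k $ c\<bar>)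
     + (grad_bound * total_clock s (Suc k) - grad_bound * total_clock s k)"
proof -
  have move: "\<bar>x (Suc k) $ c - x k $ c\<bar> \<le> grad_bound * \<alpha> k"
    using component_le_norm_cart[of "x (Suc k) - x k" c] x_step[of k] by simp
  have inc: "grad_bound * total_clock s (Suc k) - grad_bound * total_clock s k = grad_bound * \<alpha> k"
    by (simp add: total_clock_Suc \<alpha>_def algebra_simps)
  show ?thesis
  proof (cases "l = fst (s k)")
    case True
    show ?thesis
    proof (cases "c = l")
      case True
      thus ?thesis using \<open>l = fst (s k)\<close> grad_bound_nonneg \<alpha>_nonneg[of k] unfolding inc by (simp add: X_Suc)
    next
      case False
      have "X (Suc k) $ l $ c - x (Suc k) $ c
          = ((X k $ l $ c - x k $ c) + (X k $ snd (s k) $ c - x k $ c)) / 2"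
        using True False by (simp add: X_Suc x_Suc with_action_def field_simps)
      hence avg: "\<bar>X (Suc k) $ l $ c - x (Suc k) $ c\<bar>
          \<le> (\<bar>X k $ l $ c - x k $ c\<bar> + \<bar>X k $ snd (s k) $ c - x k $ c\<bar>) / 2"
        by (simp only: abs_average_le)
      have "grad_bound * \<alpha> k \<ge> 0" using grad_bound_nonneg \<alpha>_nonneg by simp
      from add_increasing2[OF this avg] show ?thesis using True unfolding inc by (simp only: simp_thms if_True)
    qed
  next
    case False
    thus ?thesis using move unfolding inc by (simp add: X_Suc)
  qed
qed

lemma err_window:
  assumes "m \<le> n"
  shows "err n \<le> err m + grad_bound * (total_clock s n - total_clock s m)"
proof (rule err_leI)
  fix l c
  have "mono (\<lambda>k. grad_bound * total_clock s k)"
    using mono_total_clock[of s] grad_bound_nonneg by (auto simp: mono_def intro!: mult_left_mono)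
  from averaging_contraction(1)[where d = "\<lambda>k l. \<bar>X k $ l $ c - x k $ c\<bar>"
    and s = s and S = "\<lambda>k. grad_bound * total_clock s k" and B = "err m" and k = m and t = "n - m" and T = "{}"
    and l = l, OF error_recursion this err_ge err_nonneg]
  show "\<bar>X n $ l $ c - x n $ c\<bar> \<le> err m + grad_bound * (total_clock s n - total_clock s m)"
    using assms by (simp add: right_diff_distrib)
qed

text \<open>For each coordinate \<open>c\<close> the errors start at zero for player
  \<open>c\<close> herself, and the word \<open>w\<close> carries her information to
  everybody.\<close>

lemma err_contract:
  assumes w: "\<And>j. spread w {j} = UNIV" and block: "\<And>r. r < length w \<Longrightarrow> s (m + r) = w ! r"
  shows "err (m + length w) \<le> (1 - 1 / 2 ^ length w) * err m
           + grad_bound * (total_clock s (m + length w) - total_clock s m)"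
proof (rule err_leI)
  fix l c
  have S: "mono (\<lambda>k. grad_bound * total_clock s k)"
    using mono_total_clock[of s] grad_bound_nonneg by (auto simp: mono_def intro!: mult_left_mono)
  have "map s [m..<m + length w] = w"
    by (rule nth_equalityI) (auto simp: block)
  hence l: "l \<in> spread (map s [m..<m + length w]) {c}" using w by simp
  have "\<bar>X m $ l $ c - x m $ c\<bar> \<le> 0" if "l \<in> {c}" for l
    using that by (simp add: diagonal)
  from averaging_contraction(2)[where d = "\<lambda>k l. \<bar>X k $ l $ c - x k $ c\<bar>"
    and s = s and S = "\<lambda>k. grad_bound * total_clock s k", OF error_recursion S err_ge err_nonneg this l]
  show "\<bar>X (m + length w) $ l $ c - x (m + length w) $ c\<bar> \<le> (1 - 1 / 2 ^ length w) * err m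
           + grad_bound * (total_clock s (m + length w) - total_clock s m)"
    by (simp add: right_diff_distrib)
qed

section \<open>Descent of the squared distance to the equilibrium\<close>

definition V :: "nat \<Rightarrow> real" where "V k = (norm (x k - xstar))\<^sup>2"

lemma gradient_error: "\<bar>grad k - own_gradient \<Omega> J (fst (s k)) (x k)\<bar> \<le> lip * (real CARD('n) * err k)"
proof -
  have "norm (gradient_point k - x k) \<le> (\<Sum>c\<in>UNIV. \<bar>(gradient_point k - x k) $ c\<bar>)"
    by (rule norm_le_l1_cart)
  also have "\<dots> \<le> (\<Sum>c\<in>(UNIV :: 'n set). err k)"
  proof (rule sum_mono)
    fix c
    show "\<bar>(gradient_point k - x k) $ c\<bar> \<le> err k"
    proof (cases "c = fst (s k)")
      case True
      thus ?thesis by (simp add: gradient_point_def with_action_def err_nonneg)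
    next
      case False
      have "(gradient_point k - x k) $ c
          = ((X k $ fst (s k) $ c - x k $ c) + (X k $ snd (s k) $ c - x k $ c)) / 2"
        using False by (simp add: gradient_point_def with_action_def field_simps)
      hence "\<bar>(gradient_point k - x k) $ c\<bar>
          \<le> (\<bar>X k $ fst (s k) $ c - x k $ c\<bar> + \<bar>X k $ snd (s k) $ c - x k $ c\<bar>) / 2"
        by (simp only: abs_average_le)
      thus ?thesis using err_ge[of k "fst (s k)" c] err_ge[of k "snd (s k)" c] by (simp add: field_simps)
    qed
  qed
  finally have "norm (gradient_point k - x k) \<le> real CARD('n) * err k" by simp
  from mult_left_mono[OF this lip_nonneg]
    own_gradient_lipschitz[OF gradient_point_profile x_profile, of "fst (s k)" k k]
  show ?thesis by (simp add: grad_def)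
qed

text \<open>The error of one step of \<open>V\<close> per unit of step size: the first summand comes
  from the inexact estimates, the second from the quadratic term of the step.\<close>

definition noise :: "nat \<Rightarrow> real" where
  "noise k = 2 * lip * CARD('n) * diam * err k + grad_bound\<^sup>2 * \<alpha> k"

text \<open>Only the drawn coordinate changes. Nonexpansiveness of the projection reduces the claim
  to expanding a square, after which the gradient used is replaced by the gradient at the true
  actions.\<close>

lemma V_step: "V (Suc k) \<le> V k - 2 * \<alpha> k * descent (fst (s k)) (x k) + \<alpha> k * noise k"
proof -
  let ?i = "fst (s k)"
  let ?u = "x k $ ?i - xstar $ ?i"
  have V_eq: "V k = (\<Sum>j\<in>UNIV. (x k $ j - xstar $ j)\<^sup>2)" for k
    unfolding V_def power2_norm_eq_inner inner_vec_def by (simp add: power2_eq_square)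
  have "V (Suc k) - V k = (\<Sum>j\<in>UNIV. (x (Suc k) $ j - xstar $ j)\<^sup>2 - (x k $ j - xstar $ j)\<^sup>2)"
    by (simp add: V_eq sum_subtractf)
  also have "\<dots> = (\<Sum>j\<in>{?i}. (x (Suc k) $ j - xstar $ j)\<^sup>2 - (x k $ j - xstar $ j)\<^sup>2)"
    by (rule sum.mono_neutral_right) (auto simp: x_Suc with_action_def)
  finally have diff: "V (Suc k) - V k = (x (Suc k) $ ?i - xstar $ ?i)\<^sup>2 - ?u\<^sup>2" by simp
  have "xstar $ ?i \<in> \<Omega> ?i" using xstar_profile by (simp add: profiles_def)
  from projected_step[OF this]
  have "(x (Suc k) $ ?i - xstar $ ?i)\<^sup>2 \<le> (?u - \<alpha> k * grad k)\<^sup>2"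
    unfolding abs_le_square_iff by (simp add: algebra_simps)
  also have "\<dots> = ?u\<^sup>2 - 2 * \<alpha> k * (grad k * ?u) + \<alpha> k * (\<alpha> k * (grad k)\<^sup>2)"
    by (simp add: power2_eq_square algebra_simps)
  finally have step: "V (Suc k) \<le> V k - 2 * \<alpha> k * (grad k * ?u) + \<alpha> k * (\<alpha> k * (grad k)\<^sup>2)"
    using diff by simp
  have u: "\<bar>?u\<bar> \<le> diam"
    using component_le_norm_cart[of "x k - xstar" ?i] norm_diff_le_diam[OF x_profile xstar_profile, of k] by simp
  have "\<bar>grad k * ?u - descent ?i (x k)\<bar> = \<bar>grad k - own_gradient \<Omega> J ?i (x k)\<bar> * \<bar>?u\<bar>"
    by (simp add: descent_def left_diff_distrib flip: abs_mult)
  also have "\<dots> \<le> lip * (real CARD('n) * err k) * diam"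
    using gradient_error[of k] u lip_nonneg err_nonneg[of k] by (intro mult_mono) auto
  finally have "2 * (descent ?i (x k) - grad k * ?u) \<le> 2 * lip * CARD('n) * diam * err k"
    by (simp add: algebra_simps abs_le_iff)
  moreover have "\<alpha> k * (grad k)\<^sup>2 \<le> grad_bound\<^sup>2 * \<alpha> k"
  proof -
    have "(grad k)\<^sup>2 \<le> grad_bound\<^sup>2"
      using grad_le[of k] grad_bound_nonneg by (simp add: abs_le_square_iff[symmetric])
    from mult_left_mono[OF this \<alpha>_nonneg[of k]] show ?thesis by (simp add: mult.commute)
  qed
  ultimately have "2 * (descent ?i (x k) - grad k * ?u) + \<alpha> k * (grad k)\<^sup>2 \<le> noise k"
    by (simp add: noise_def)
  from mult_left_mono[OF this \<alpha>_nonneg[of k]] step show ?thesis by (simp add: algebra_simps)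
qed

text \<open>Freezing \<open>descent\<close> at one reference profile \<open>y\<close> lets the steps
  of each player add up to the increment of her clock. By Lipschitz continuity, freezing costs at
  most a multiple of \<open>R\<close> per unit of step size.\<close>

lemma V_window:
  assumes "m \<le> n" and y: "y \<in> profiles \<Omega>"
    and R: "\<And>k. m \<le> k \<Longrightarrow> k < n \<Longrightarrow> norm (x k - y) \<le> R"
    and \<rho>: "\<And>k. m \<le> k \<Longrightarrow> k < n \<Longrightarrow> noise k \<le> \<rho>"
  shows "V n \<le> V m - 2 * (\<Sum>i\<in>UNIV. descent i y * (clock s i n - clock s i m))
    + (2 * (lip * diam + grad_bound) * R + \<rho>) * (total_clock s n - total_clock s m)"
  using \<open>m \<le> n\<close> R \<rho>
proof (induction n rule: dec_induct)
  case (step n)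
  let ?i = "fst (s n)" and ?\<Lambda> = "lip * diam + grad_bound"
  have "\<bar>descent ?i (x n) - descent ?i y\<bar> \<le> ?\<Lambda> * norm (x n - y)"
    by (rule descent_lipschitz[OF x_profile y])
  also have "\<dots> \<le> ?\<Lambda> * R"
    using lip_nonneg diam_nonneg grad_bound_nonneg step by (intro mult_left_mono) auto
  finally have lip_step: "\<bar>descent ?i (x n) - descent ?i y\<bar> \<le> ?\<Lambda> * R" .
  have "noise n \<le> \<rho>" using step by auto
  with lip_step have "- 2 * descent ?i (x n) + noise n \<le> - 2 * descent ?i y + (2 * (?\<Lambda> * R) + \<rho>)"
    by linarith
  from mult_left_mono[OF this \<alpha>_nonneg[of n]] V_step[of n]
  have "V (Suc n) \<le> V n - 2 * (\<alpha> n * descent ?i y) + (2 * (?\<Lambda> * R) + \<rho>) * \<alpha> n"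
    by (simp add: algebra_simps)
  moreover have "(\<Sum>i\<in>UNIV. descent i y * (clock s i (Suc n) - clock s i m))
      = (\<Sum>i\<in>UNIV. descent i y * (clock s i n - clock s i m)) + \<alpha> n * descent ?i y"
  proof -
    have "(\<Sum>i\<in>UNIV. descent i y * (clock s i (Suc n) - clock s i m))
      = (\<Sum>i\<in>UNIV. descent i y * (clock s i n - clock s i m) + (if i = ?i then \<alpha> n * descent i y else 0))"
      by (intro sum.cong) (auto simp: clock_Suc \<alpha>_def algebra_simps)
    thus ?thesis by (simp add: sum.distrib)
  qed
  moreover have "V n \<le> V m - 2 * (\<Sum>i\<in>UNIV. descent i y * (clock s i n - clock s i m))
    + (2 * ?\<Lambda> * R + \<rho>) * (total_clock s n - total_clock s m)"
    by (rule step.IH) (use step in auto)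
  ultimately show ?case
    by (simp add: total_clock_Suc \<alpha>_def algebra_simps)
qed simp

end

section \<open>Convergence\<close>

lemma clock_drift:
  fixes s :: "nat \<Rightarrow> 'n::finite \<times> 'n"
  assumes freq: "\<And>i. (\<lambda>n. real (num_updates s i n) / real n) \<longlonglongrightarrow> 1 / real CARD('n)"
    and u: "filterlim u at_top sequentially" and v: "filterlim v at_top sequentially"
    and ratio: "(\<lambda>n. real (u n) / real (v n)) \<longlonglongrightarrow> exp l"
  shows "(\<lambda>n. clock s i (u n) - clock s i (v n)) \<longlonglongrightarrow> l"
    and "(\<lambda>n. total_clock s (u n) - total_clock s (v n)) \<longlonglongrightarrow> real CARD('n) * l"
proof -
  have drift: "(\<lambda>n. clock s i (u n) - clock s i (v n)) \<longlonglongrightarrow> l" for i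
    unfolding clock_def by (rule harm_frequency_diff_tendsto[OF freq _ u v ratio]) simp
  show "(\<lambda>n. clock s i (u n) - clock s i (v n)) \<longlonglongrightarrow> l" by (rule drift)
  have "(\<lambda>n. \<Sum>i\<in>UNIV. clock s i (u n) - clock s i (v n)) \<longlonglongrightarrow> (\<Sum>i\<in>(UNIV :: 'n set). l)"
    by (intro tendsto_sum drift)
  thus "(\<lambda>n. total_clock s (u n) - total_clock s (v n)) \<longlonglongrightarrow> real CARD('n) * l"
    by (simp add: total_clock_def sum_subtractf)
qed

text \<open>For passing from multiples of the block length to all indices: the rounding is
  negligible in logarithmic time.\<close>

lemma rounded_down_ratio:
  assumes "m > 0"
  shows "(\<lambda>k. real (k div m * m) / real k) \<longlonglongrightarrow> 1"
proof (rule tendsto_sandwich)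
  show "\<forall>\<^sub>F k in sequentially. 1 - real m / real k \<le> real (k div m * m) / real k"
    using eventually_gt_at_top[of 0]
  proof eventually_elim
    case (elim k)
    have "k div m * m + k mod m = k" "k mod m < m" using assms by auto
    hence "real k - real m \<le> real (k div m * m)" by linarith
    hence "(real k - real m) / real k \<le> real (k div m * m) / real k"
      by (rule divide_right_mono) simp
    thus ?case using elim by (simp add: diff_divide_distrib)
  qed
  show "\<forall>\<^sub>F k in sequentially. real (k div m * m) / real k \<le> 1"
    using eventually_gt_at_top[of 0]
  proof eventually_elim
    case (elim k)
    have "real (k div m * m) \<le> real k" by (simp only: of_nat_le_iff div_times_less_eq_dividend)
    thus ?case using elim by simp
  qed
  show "(\<lambda>k. 1 - real m / real k) \<longlonglongrightarrow> 1"
    using tendsto_diff[OF tendsto_const[of "1::real"] tendsto_mult[OF tendsto_const[of "real m"] lim_1_over_n]]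
    by simp
qed simp

context gossip_run
begin

context
  fixes w :: "('n \<times> 'n) list" and p :: real
  assumes freq: "\<And>i. (\<lambda>n. real (num_updates s i n) / real n) \<longlonglongrightarrow> 1 / real CARD('n)"
    and w: "w \<noteq> []" "\<And>j. spread w {j} = UNIV"
    and blocks: "(\<lambda>n. real (card {q. q < n \<and> (\<forall>r<length w. s (q * length w + r) = w ! r)}) / real n) \<longlonglongrightarrow> p"
    and p: "p > 0"
begin

text \<open>The step is the increment of \<open>total_clock\<close> over one iteration, a window of
  asymptotic length \<open>l = 0\<close>.\<close>

lemma \<alpha>_tendsto: "\<alpha> \<longlonglongrightarrow> 0"
proof -
  have "(\<lambda>n. total_clock s (Suc n) - total_clock s n) \<longlonglongrightarrow> real CARD('n) * 0"
    by (rule clock_drift(2)[OF freq filterlim_Suc filterlim_ident])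
       (use LIMSEQ_Suc_n_over_n[where 'a = real] in simp)
  thus ?thesis by (simp add: total_clock_Suc \<alpha>_def[abs_def])
qed

lemma err_tendsto: "err \<longlonglongrightarrow> 0"
proof -
  let ?m = "length w"
  have m: "?m > 0" using w by simp
  have times_m: "filterlim (\<lambda>q. q * ?m) at_top sequentially"
    using m by (intro filterlim_subseq) (simp add: strict_mono_def)
  have S: "mono (\<lambda>q. grad_bound * total_clock s (q * ?m))"
    using mono_total_clock[of s] grad_bound_nonneg by (auto simp: mono_def intro!: mult_left_mono)
  \<comment> \<open>Along multiples of the block length the error contracts at each block that
    spells \<open>w\<close>, and never grows by more than the drift.\<close>
  have blockwise: "(\<lambda>q. err (q * ?m)) \<longlonglongrightarrow> 0"
  proof (rule frequent_contraction_tendsto_zero[OF err_nonneg err_le_diam _ _ _ S blocks p])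
    show "0 \<le> 1 - 1 / (2 :: real) ^ ?m" "1 - 1 / (2 :: real) ^ ?m < 1" by auto
    show "err (Suc q * ?m) \<le> (if \<forall>r<?m. s (q * ?m + r) = w ! r then 1 - 1 / 2 ^ ?m else 1) * err (q * ?m)
        + (grad_bound * total_clock s (Suc q * ?m) - grad_bound * total_clock s (q * ?m))" for q
    proof (cases "\<forall>r<?m. s (q * ?m + r) = w ! r")
      case True
      hence "err (q * ?m + ?m) \<le> (1 - 1 / 2 ^ ?m) * err (q * ?m)
          + grad_bound * (total_clock s (q * ?m + ?m) - total_clock s (q * ?m))"
        by (intro err_contract w) simp
      thus ?thesis using True by (simp add: right_diff_distrib add.commute)
    next
      case False
      have "err (q * ?m + ?m) \<le> err (q * ?m) + grad_bound * (total_clock s (q * ?m + ?m) - total_clock s (q * ?m))"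
        by (rule err_window) simp
      thus ?thesis unfolding if_not_P[OF False] by (simp add: right_diff_distrib add.commute)
    qed
    fix l :: real
    \<comment> \<open>The window is counted in blocks; the block length cancels in the ratio of its
      end points.\<close>
    have "(\<lambda>n. real (n * ?m) / real (look_back l n * ?m)) \<longlonglongrightarrow> exp l"
      using look_back_inverse_ratio[of l] w by simp
    from tendsto_mult_left[OF clock_drift(2)[OF freq times_m filterlim_compose[OF times_m look_back_at_top] this], of grad_bound]
    show "(\<lambda>n. grad_bound * total_clock s (n * ?m) - grad_bound * total_clock s (look_back l n * ?m))
        \<longlonglongrightarrow> grad_bound * real CARD('n) * l"
      by (simp add: right_diff_distrib mult.assoc)
  qed
  have ratio: "(\<lambda>k. real (k div ?m * ?m) / real k) \<longlonglongrightarrow> 1" by (rule rounded_down_ratio[OF m])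
  have round_top: "filterlim (\<lambda>k. k div ?m * ?m) at_top sequentially"
    by (rule positive_frequency_at_top[OF ratio]) simp
  have "(\<lambda>k. real (k div ?m) / real k) \<longlonglongrightarrow> 1 / real ?m"
    using tendsto_divide[OF ratio tendsto_const[of "real ?m"]] m by simp
  hence div_top: "filterlim (\<lambda>k. k div ?m) at_top sequentially"
    by (rule positive_frequency_at_top) (use m in simp)
  \<comment> \<open>From the last block boundary up to \<open>k\<close> the clocks advance by a
    vanishing amount, so convergence along the boundaries suffices.\<close>
  have "(\<lambda>k. real k / real (k div ?m * ?m)) \<longlonglongrightarrow> exp 0"
    using tendsto_inverse[OF ratio] by simp
  from clock_drift(2)[OF freq filterlim_ident round_top this]
  have "(\<lambda>k. err (k div ?m * ?m) + grad_bound * (total_clock s k - total_clock s (k div ?m * ?m)))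
      \<longlonglongrightarrow> 0 + grad_bound * (real CARD('n) * 0)"
    by (intro tendsto_intros filterlim_compose[OF blockwise div_top])
  hence lim: "(\<lambda>k. err (k div ?m * ?m) + grad_bound * (total_clock s k - total_clock s (k div ?m * ?m))) \<longlonglongrightarrow> 0"
    by simp
  show ?thesis
  proof (rule tendsto_sandwich[OF _ _ tendsto_const lim])
    show "\<forall>\<^sub>F k in sequentially. 0 \<le> err k" by (simp add: err_nonneg)
    show "\<forall>\<^sub>F k in sequentially. err k
        \<le> err (k div ?m * ?m) + grad_bound * (total_clock s k - total_clock s (k div ?m * ?m))"
      by (intro always_eventually allI err_window) simp
  qed
qed

lemma noise_tendsto: "noise \<longlonglongrightarrow> 0"
proof -
  have "(\<lambda>k. 2 * lip * CARD('n) * diam * err k + grad_bound\<^sup>2 * \<alpha> k)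
      \<longlonglongrightarrow> 2 * lip * CARD('n) * diam * 0 + grad_bound\<^sup>2 * 0"
    by (intro tendsto_intros err_tendsto \<alpha>_tendsto)
  thus ?thesis by (simp add: noise_def[abs_def])
qed

lemma V_tendsto: "V \<longlonglongrightarrow> 0"
proof (rule tendsto_zero_by_descent)
  show "0 \<le> V n" for n by (simp add: V_def)
  show "V n \<le> diam\<^sup>2" for n
    unfolding V_def by (intro power_mono norm_diff_le_diam x_profile xstar_profile) simp
  fix e :: real assume "e > 0"
  then obtain c where c: "c > 0"
    "\<And>x. x \<in> profiles \<Omega> \<Longrightarrow> (norm (x - xstar))\<^sup>2 \<ge> e \<Longrightarrow> (\<Sum>i\<in>UNIV. descent i x) \<ge> c"
    using descent_sum_pos by blast
  define N where "N = real CARD('n)"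
  have N: "N > 0" by (simp add: N_def)
  define \<Lambda> where "\<Lambda> = lip * diam + grad_bound"
  \<comment> \<open>The bound \<open>small\<close> is \<open>a * l / 2 + N * \<rho> < c\<close>: the
    choice of \<open>\<rho>\<close> spends half of \<open>c\<close>, and \<open>a * l < c\<close>
    keeps the other term below the other half. The \<open>1\<close> in
    \<open>l = c / (a + 1)\<close> covers \<open>a = 0\<close>.\<close>
  define a where "a = 4 * \<Lambda> * grad_bound * N\<^sup>2"
  have a: "a \<ge> 0"
    unfolding a_def \<Lambda>_def using lip_nonneg diam_nonneg grad_bound_nonneg N by simp
  define l where "l = c / (a + 1)"
  define \<rho> where "\<rho> = c / (2 * N)"
  have l: "l > 0" using a c by (simp add: l_def)
  have \<rho>: "\<rho> > 0" using c N by (simp add: \<rho>_def)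
  have "a * l < c" using a c by (simp add: l_def field_simps)
  hence small: "(2 * \<Lambda> * (grad_bound * (N * l)) + \<rho>) * N < c"
    using N by (simp add: a_def \<rho>_def field_simps power2_eq_square)
  let ?b = "look_back l"
  define T where "T n = total_clock s n - total_clock s (?b n)" for n
  define dev where "dev n = (\<Sum>i\<in>UNIV. \<bar>clock s i n - clock s i (?b n) - l\<bar>)" for n
  \<comment> \<open>All errors over the window: unequal advance of the clocks, freezing of
    \<open>descent\<close>, and noise. The limit lies below \<open>l * c\<close>, half of the
    guaranteed decrease \<open>2 * (l * c)\<close>.\<close>
  define rest where "rest n = 2 * (grad_bound * diam) * dev n + (2 * \<Lambda> * (grad_bound * T n) + \<rho>) * T n" for n
  note drift = clock_drift[OF freq filterlim_ident look_back_at_top look_back_inverse_ratio[of l]]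
  have T: "T \<longlonglongrightarrow> N * l" unfolding T_def N_def by (rule drift(2))
  have "dev \<longlonglongrightarrow> (\<Sum>i\<in>(UNIV :: 'n set). \<bar>l - l\<bar>)"
    unfolding dev_def by (intro tendsto_intros drift(1))
  hence dev: "dev \<longlonglongrightarrow> 0" by simp
  have "rest \<longlonglongrightarrow> 2 * (grad_bound * diam) * 0 + (2 * \<Lambda> * (grad_bound * (N * l)) + \<rho>) * (N * l)"
    unfolding rest_def by (intro tendsto_intros T dev)
  moreover have "2 * (grad_bound * diam) * 0 + (2 * \<Lambda> * (grad_bound * (N * l)) + \<rho>) * (N * l) < l * c"
    using mult_strict_left_mono[OF small l] by (simp add: algebra_simps)
  ultimately have rest: "\<forall>\<^sub>F n in sequentially. rest n < l * c"
    by (rule order_tendstoD(2))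
  have "\<forall>\<^sub>F k in sequentially. noise k < \<rho>"
    by (rule order_tendstoD(2)[OF noise_tendsto \<rho>])
  then obtain K where K: "\<And>k. k \<ge> K \<Longrightarrow> noise k < \<rho>"
    by (auto simp: eventually_at_top_linorder)
  have late: "\<forall>\<^sub>F n in sequentially. K \<le> ?b n"
    using look_back_at_top[of l] by (simp add: filterlim_at_top)
  have "\<forall>\<^sub>F n in sequentially. e \<le> V n \<longrightarrow> V n \<le> V (?b n) - l * c"
    using rest late
  proof eventually_elim
    case (elim n)
    show ?case
    proof
      assume "e \<le> V n"
      hence cn: "(\<Sum>i\<in>UNIV. descent i (x n)) \<ge> c" using c(2)[OF x_profile] by (simp add: V_def)
      have bn: "?b n \<le> n" using l by (intro look_back_le) simp
      \<comment> \<open>The reference profile is the end point \<open>x n\<close>, since it is there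
        that \<open>e \<le> V n\<close> bounds the sum of \<open>descent\<close> from below.\<close>
      have "V n \<le> V (?b n) - 2 * (\<Sum>i\<in>UNIV. descent i (x n) * (clock s i n - clock s i (?b n)))
          + (2 * (lip * diam + grad_bound) * (grad_bound * T n) + \<rho>) * (total_clock s n - total_clock s (?b n))"
      proof (rule V_window[OF bn x_profile])
        fix k assume k: "?b n \<le> k" "k < n"
        show "noise k \<le> \<rho>" using K[of k] k elim by simp
        have "norm (x k - x n) \<le> grad_bound * (total_clock s n - total_clock s k)"
          using x_window[of k n] k by (simp add: norm_minus_commute)
        also have "\<dots> \<le> grad_bound * T n"
          using monoD[OF mono_total_clock k(1), of s] grad_bound_nonneg
          by (intro mult_left_mono) (auto simp: T_def)
        finally show "norm (x k - x n) \<le> grad_bound * T n" .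
      qed
      moreover have "(\<Sum>i\<in>UNIV. descent i (x n) * (clock s i n - clock s i (?b n))) \<ge> l * c - grad_bound * diam * dev n"
      proof -
        have "(\<Sum>i\<in>UNIV. descent i (x n) * (clock s i n - clock s i (?b n)))
            \<ge> (\<Sum>i\<in>UNIV. l * descent i (x n) - grad_bound * diam * \<bar>clock s i n - clock s i (?b n) - l\<bar>)"
        proof (rule sum_mono)
          fix i
          let ?d = "clock s i n - clock s i (?b n) - l"
          \<comment> \<open>Only the deviation of the clock increment from \<open>l\<close> needs a
            bound on the absolute value of \<open>descent\<close>, whose individual summands may
            have either sign.\<close>
          have "- (descent i (x n) * ?d) \<le> \<bar>descent i (x n)\<bar> * \<bar>?d\<bar>"
            by (metis abs_ge_minus_self abs_mult)
          also have "\<dots> \<le> grad_bound * diam * \<bar>?d\<bar>"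
            by (intro mult_right_mono descent_bound x_profile) simp
          finally show "l * descent i (x n) - grad_bound * diam * \<bar>?d\<bar>
              \<le> descent i (x n) * (clock s i n - clock s i (?b n))"
            by (simp add: algebra_simps)
        qed
        also have "(\<Sum>i\<in>UNIV. l * descent i (x n) - grad_bound * diam * \<bar>clock s i n - clock s i (?b n) - l\<bar>)
            = l * (\<Sum>i\<in>UNIV. descent i (x n)) - grad_bound * diam * dev n"
          by (simp add: sum_subtractf dev_def sum_distrib_left)
        finally show ?thesis using mult_left_mono[OF cn less_imp_le[OF l]] by linarith
      qed
      ultimately have "V n \<le> V (?b n) - 2 * (l * c) + rest n"
        by (simp add: rest_def T_def \<Lambda>_def)
      thus "V n \<le> V (?b n) - l * c" using elim by simp
    qed
  qed
  thus "\<exists>\<kappa>>0. \<exists>b. filterlim b at_top sequentially \<and> (\<forall>\<^sub>F n in sequentially. e \<le> V n \<longrightarrow> V n \<le> V (b n) - \<kappa>)"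
    using look_back_at_top l c by (intro exI[of _ "l * c"] conjI exI[of _ ?b]) auto
qed

lemma actions_tendsto: "actions \<Omega> J X0 s \<longlonglongrightarrow> xstar"
proof -
  have "(\<lambda>k. sqrt (V k)) \<longlonglongrightarrow> sqrt 0" by (intro tendsto_intros V_tendsto)
  hence "(\<lambda>k. norm (x k - xstar)) \<longlonglongrightarrow> 0" by (simp add: V_def)
  thus ?thesis by (simp add: tendsto_norm_zero_iff LIM_zero_iff x_def)
qed

end

end

section \<open>Almost sure convergence\<close>

theorem theorem2:
  fixes \<Omega> :: "'n::finite \<Rightarrow> real set"
    and J :: "'n \<Rightarrow> real ^ 'n \<Rightarrow> real"
    and \<sigma> L :: "'n \<Rightarrow> real"
    and E :: "('n \<times> 'n) set"
    and X0 :: "real ^ 'n ^ 'n"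
    and M :: "'w measure"
    and draw :: "nat \<Rightarrow> 'w \<Rightarrow> 'n \<times> 'n"
    and xstar :: "real ^ 'n"
  assumes action_sets: "\<And>i. \<Omega> i \<noteq> {} \<and> compact (\<Omega> i) \<and> convex (\<Omega> i)"
    and cost_C1: "\<And>i. C1_in_own_action \<Omega> J i"
    and cost_continuous: "\<And>i. continuous_on (profiles \<Omega>) (J i)"
    and cost_convex: "\<And>i x. x \<in> profiles \<Omega> \<Longrightarrow> convex_on (\<Omega> i) (\<lambda>t. J i (with_action x i t))"
    and strictly_monotone: "strictly_monotone_on (profiles \<Omega>) (pseudo_gradient \<Omega> J)"
    and lipschitz_consts: "\<And>i. \<sigma> i > 0 \<and> L i > 0"
    and lipschitz_own: "\<And>i x. x \<in> profiles \<Omega> \<Longrightarrow>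
          (\<sigma> i)-lipschitz_on (\<Omega> i) (\<lambda>t. own_gradient \<Omega> J i (with_action x i t))"
    and lipschitz_others: "\<And>i t. t \<in> \<Omega> i \<Longrightarrow>
          (L i)-lipschitz_on {x \<in> profiles \<Omega>. x $ i = t} (own_gradient \<Omega> J i)"
    and strongly_connected: "strongly_connected_digraph E"
    and initial: "\<And>l. X0 $ l \<in> profiles \<Omega>"
    and prob_space: "prob_space M"
    and draws_indep: "prob_space.indep_vars M (\<lambda>_. count_space UNIV) draw UNIV"
    and draws_law: "\<And>k. distr M (count_space UNIV) (draw k) = measure_pmf (gossip_pmf E)"
    and nash: "nash_equilibrium \<Omega> J xstar"
  shows "AE \<omega> in M. (\<lambda>k. actions \<Omega> J X0 (\<lambda>l. draw l \<omega>) k) \<longlonglongrightarrow> xstar"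
proof -
  interpret prob_space M by (rule prob_space)
  have [measurable]: "draw k \<in> M \<rightarrow>\<^sub>M count_space UNIV" for k
    using draws_indep by (auto simp: indep_vars_def)
  obtain u where u: "set u \<subseteq> {(i, j). (j, i) \<in> E}" "\<And>j. spread u {j} = UNIV"
    using exists_spreading_word[OF strongly_connected] by blast
  \<comment> \<open>With a single player the spreading word \<open>u\<close> may be empty; an
    arbitrary possible draw \<open>z\<close> in front makes the block length positive.\<close>
  obtain z where z: "z \<in> set_pmf (gossip_pmf E)" using set_pmf_not_empty[of "gossip_pmf E"] by blast
  define w where "w = z # u"
  have w: "w \<noteq> []" "set w \<subseteq> set_pmf (gossip_pmf E)"
    using u(1) z in_neighbours_set_pmf[of E] by (auto simp: w_def)
  have spread_w: "spread w {j} = UNIV" for j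
  proof -
    have "spread u {j} \<subseteq> spread u (spread [z] {j})" by (intro spread_mono subset_spread)
    thus ?thesis using u(2)[of j] spread_append[of "[z]" u "{j}"] by (auto simp: w_def)
  qed
  have p: "(\<Prod>r<length w. pmf (gossip_pmf E) (w ! r)) > 0"
    using w by (intro prod_pos) (auto simp: pmf_positive_iff)
  have update: "AE \<omega> in M. (\<lambda>n. real (num_updates (\<lambda>l. draw l \<omega>) i n) / real n) \<longlonglongrightarrow> 1 / real CARD('n)" for i
    unfolding num_updates_def
  proof (rule slln_events)
    show "indep_vars (\<lambda>_. count_space UNIV) (\<lambda>q \<omega>. fst (draw q \<omega>) = i) UNIV"
      by (rule indep_vars_compose2[OF draws_indep]) auto
    fix q
    have "prob {\<omega> \<in> space M. fst (draw q \<omega>) = i}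
        = measure (distr M (count_space UNIV) (draw q)) (fst -` {i})"
      by (subst measure_distr) (auto simp: vimage_def intro!: arg_cong[where f = prob])
    also have "\<dots> = pmf (map_pmf fst (gossip_pmf E)) i"
      by (simp add: draws_law pmf_map)
    also have "\<dots> = 1 / real CARD('n)"
      by (simp add: map_fst_gossip_pmf)
    finally show "prob {\<omega> \<in> space M. fst (draw q \<omega>) = i} = 1 / real CARD('n)" .
  qed
  \<comment> \<open>There are finitely many players, so one null set serves for all their
    frequencies.\<close>
  have "AE \<omega> in M. \<forall>i. (\<lambda>n. real (num_updates (\<lambda>l. draw l \<omega>) i n) / real n) \<longlonglongrightarrow> 1 / real CARD('n)"
    by (subst AE_all_countable) (use update in blast)
  moreover note slln_blocks[OF draws_indep draws_law w(1)]
  ultimately show ?thesis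
  proof eventually_elim
    case (elim \<omega>)
    interpret gossip_run \<Omega> J \<sigma> L xstar X0 "\<lambda>l. draw l \<omega>"
      by unfold_locales (fact action_sets cost_C1 strictly_monotone lipschitz_consts lipschitz_own
          lipschitz_others nash initial)+
    show ?case
      by (rule actions_tendsto[OF _ w(1) spread_w elim(2) p]) (use elim(1) in blast)
  qed
qed

end
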